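(* Let $t\ge2$ be an integer and $g=2t-2$. Let $\lambda\in\mathcal{DD}_{g}^{'2}$, let $\mathbf{v}\in\mathbb{Z}^t$ be its $V_{g,t}$-coding, and set $r_i=v_i-g/2+1$ for $1\le i\le t$. Then $$|\lambda| = \frac{1}{g}\sum_{i=1}^{t} r_i^2-\frac{(g/2+1)(g+1)}{12}.$$ Moreover, setting $\alpha_i(\lambda)=\#\{s\in\lambda\mid h_s=g-i,\ \varepsilon'_s=1\}$, for any field $F$ and any function $\tau:\mathbb{Z}\to F^{\times}$, $$\prod_{s\in\lambda}\frac{\tau(h_s-\varepsilon'_s g)}{\tau(h_s)}=\prod_{s\in\lambda'}\frac{\tau(h_s+\varepsilon_s g)}{\tau(h_s)}=\prod_{i=1}^{g-1}\left(\frac{\tau(-i)}{\tau(i)}\right)^{\alpha_i(\lambda)}\prod_{i=1}^t\frac{\tau(2r_i)}{\tau(r_i)}\prod_{i=1}^{t-1}\frac{\tau(i)}{\tau(2i)}\prod_{1\le i<j\le t} \frac{\tau(r_i-r_j)}{\tau(j-i)}\, \frac{\tau(r_i+r_j)}{\tau(g+2-i-j)},$$ where $\lambda'$ is the conjugate of $\lambda$.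
   Context: For a partition, $h_s$ is the hook length of a box $s$. In the Ferrers diagram (English convention): $\varepsilon_s=-1$ if $s$ is strictly below the main diagonal and $\varepsilon_s=1$ otherwise; $\varepsilon'_s=1$ if $s$ is strictly above the main diagonal and $\varepsilon'_s=-1$ otherwise. With $d_\lambda=\max\{s:\lambda_s\ge s\}$, $\mathcal{DD}$ is the set of partitions with $\lambda_i=\lambda'_i+1$ for $1\le i\le d_\lambda$ ($\lambda'$ the conjugate; the empty partition included), and $\mathcal{DD}'=\{\lambda'\mid\lambda\in\mathcal{DD}\}$. Word of a partition: $\psi(\lambda)=(c_k)_{k\in\mathbb{Z}}\in\{0,1\}^{\mathbb{Z}}$ encodes the border of the Ferrers diagram read from South-West to North-East ($0$ vertical step, $1$ horizontal step), indexed so that $\#\{k\le -1: c_k=1\}=\#\{k\ge 0: c_k=0\}$; equivalently $c_k=0$ iff $k=\lambda_i-i$ for some $i\ge1$ (with $\lambda_i=0$ beyond the length). The $g$-quotient of $\lambda$ is $(\nu^{(0)},\dots,\nu^{(g-1)})$, where $\nu^{(k)}$ is the partition whose word is, up to a shift of indices, the subword $(c_{gi+k})_{i\in\mathbb{Z}}$. $\mathcal{DD}_{2t-2}^{'2}$ is the set of $\lambda\in\mathcal{DD}'$ whose $(2t-2)$-quotient satisfies: $\nu^{(k)}=\emptyset$ for all $k\notin\{t-2,2t-3\}$; $\nu^{(2t-3)}$ is, for some integer $m_1\ge1$, the rectangular partition with $m_1$ parts all equal to $m_1-1$ (empty if $m_1=1$); and $\nu^{(t-2)}$ is, for some integer $m_t\ge0$,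 the $m_t\times m_t$ square partition. $V_{g,t}$-coding: for $i\in\{0,\dots,g-1\}$ let $\beta_i=\max\{(k+1)g+i\mid k\in\mathbb{Z},\ c_{kg+i}=0\}$; the $V_{g,t}$-coding is $\mathbf{v}=(v_1>\dots>v_t)$, the $t$ largest of the distinct integers $\beta_0,\dots,\beta_{g-1}$ in decreasing order. *)

theory Defs
  imports Complex_Main
begin

definition is_partition :: "nat list \<Rightarrow> bool" where
  "is_partition lam \<longleftrightarrow> sorted_wrt (\<ge>) lam \<and> (\<forall>x\<in>set lam. 0 < x)"

text \<open>Parts are numbered from 1 and vanish beyond the length.\<close>

definition part :: "nat list \<Rightarrow> nat \<Rightarrow> nat" where
  "part lam i = (if 1 \<le> i \<and> i \<le> length lam then lam ! (i - 1) else 0)"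

definition conj_part :: "nat list \<Rightarrow> nat list" where
  "conj_part lam = map (\<lambda>j. card {i. 1 \<le> i \<and> i \<le> length lam \<and> j \<le> part lam i}) [1..<Suc (part lam 1)]"

text \<open>Boxes are pairs (row, column), both numbered from 1, rows from top to bottom.\<close>

definition boxes :: "nat list \<Rightarrow> (nat \<times> nat) set" where
  "boxes lam = {(i, j). 1 \<le> i \<and> i \<le> length lam \<and> 1 \<le> j \<and> j \<le> part lam i}"

definition hook :: "nat list \<Rightarrow> nat \<times> nat \<Rightarrow> int" where
  "hook lam = (\<lambda>(i, j). (int (part lam i) - int j) + (int (part (conj_part lam) j) - int i) + 1)"

definition eps :: "nat \<times> nat \<Rightarrow> int" where
  "eps = (\<lambda>(i, j). if j < i then -1 else 1)"

definition eps' :: "nat \<times> nat \<Rightarrow> int" where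
  "eps' = (\<lambda>(i, j). if i < j then 1 else -1)"

text \<open>Since \<open>part lam 0 = 0\<close>, the set below always contains 0; hence the value for the empty
  partition is 0, and for nonempty partitions the extra element 0 does not affect the maximum.\<close>

definition durfee :: "nat list \<Rightarrow> nat" where
  "durfee lam = Max {s. s \<le> part lam s}"

definition DD :: "nat list set" where
  "DD = {lam. is_partition lam \<and>
    (\<forall>i. 1 \<le> i \<and> i \<le> durfee lam \<longrightarrow> part lam i = part (conj_part lam) i + 1)}"

definition DD' :: "nat list set" where
  "DD' = conj_part ` DD"

definition word :: "nat list \<Rightarrow> int \<Rightarrow> nat" where
  "word lam k = (if \<exists>i\<ge>1. k = int (part lam i) - int i then 0 else 1)"

text \<open>The function \<open>nu\<close>, restricted to \<open>{..<g}\<close>, is the \<open>g\<close>-quotient of \<open>lam\<close>; the integer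
  \<open>s\<close> is the shift of indices.\<close>

definition is_quotient :: "nat \<Rightarrow> nat list \<Rightarrow> (nat \<Rightarrow> nat list) \<Rightarrow> bool" where
  "is_quotient g lam nu \<longleftrightarrow>
    (\<forall>k<g. is_partition (nu k) \<and>
      (\<exists>s. \<forall>i. word (nu k) i = word lam (int g * (i + s) + int k)))"

text \<open>The partition with \<open>a\<close> parts equal to \<open>b\<close>.\<close>

definition rect :: "nat \<Rightarrow> nat \<Rightarrow> nat list" where
  "rect a b = (if b = 0 then [] else replicate a b)"

text \<open>The elements of \<open>DD'\<close> satisfying the condition on the \<open>(2t-2)\<close>-quotient; only used for \<open>t \<ge> 2\<close>.\<close>

definition DD'2 :: "nat \<Rightarrow> nat list set" where
  "DD'2 t = {lam \<in> DD'. \<exists>nu. is_quotient (2*t-2) lam nu \<and>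
    (\<forall>k<2*t-2. k \<notin> {t-2, 2*t-3} \<longrightarrow> nu k = []) \<and>
    (\<exists>m1\<ge>1. nu (2*t-3) = rect m1 (m1 - 1)) \<and>
    (\<exists>mt. nu (t-2) = rect mt mt)}"

definition beta :: "nat \<Rightarrow> nat list \<Rightarrow> nat \<Rightarrow> int" where
  "beta g lam i = (GREATEST b. \<exists>k. b = (k + 1) * int g + int i \<and> word lam (k * int g + int i) = 0)"

definition V_coding :: "nat \<Rightarrow> nat \<Rightarrow> nat list \<Rightarrow> int list" where
  "V_coding g t lam = take t (rev (sorted_list_of_set (beta g lam ` {..<g})))"

definition alpha :: "nat \<Rightarrow> nat list \<Rightarrow> nat \<Rightarrow> nat" where
  "alpha g lam i = card {s \<in> boxes lam. hook lam s = int g - int i \<and> eps' s = 1}"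

end

theory Submission
  imports Defs
begin

text \<open>Put \<open>X = {\<lambda>\<^sub>i - i + 1}\<close>. Boxes of \<open>\<lambda>\<close> are pairs \<open>x \<in> X\<close>, \<open>y \<notin> X\<close>, \<open>y < x\<close>, with
  hook length \<open>x - y\<close>, and \<open>\<lambda> \<in> DD'\<close> says that \<open>0 \<in> X\<close> and that negation exchanges \<open>X\<close> and
  its complement away from 0; a box then lies strictly above the diagonal iff \<open>x + y > 0\<close>. Folding
  along this symmetry expresses the product over the boxes by the positive part of \<open>X\<close> alone.
  The quotient condition says that this positive part is a union of \<open>t\<close> chains of step \<open>g\<close>,
  running from \<open>e\<^sub>i + g/2\<close> to \<open>r\<^sub>i - g/2\<close>, where \<open>\<bar>e\<^sub>i\<bar>\<close> takes each value in \<open>{0..g/2}\<close> once.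
  If \<open>\<tau>\<close> is even, the logarithm of the product is a sum of second differences
  with step \<open>g\<close>, so it telescopes along the chains and only the \<open>r\<^sub>i\<close> and \<open>e\<^sub>i\<close> survive;
  the exponents \<open>\<alpha>\<^sub>i\<close> account for the failure of evenness, since \<open>h\<^sub>s - g\<close> is negative exactly for
  the boxes above the diagonal with \<open>h\<^sub>s < g\<close>.\<close>

section \<open>Sums over pairs\<close>

text \<open>The order on the index type only selects one orientation of each pair. For symmetric
  \<open>G\<close> this is a sum over two-element subsets, which is why most lemmas below ask for
  symmetry.\<close>

definition pair_sum :: "('i::linorder \<Rightarrow> 'i \<Rightarrow> 'b::comm_monoid_add) \<Rightarrow> 'i set \<Rightarrow> 'b" where
  "pair_sum G A = (\<Sum>x\<in>A. \<Sum>y\<in>{y\<in>A. y < x}. G x y)"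

lemma pair_sum_empty [simp]: "pair_sum G {} = 0"
  by (simp add: pair_sum_def)

lemma pair_sum_add: "pair_sum (\<lambda>x y. G x y + G' x y) A = pair_sum G A + pair_sum G' A"
  by (simp add: pair_sum_def sum.distrib)

lemma pair_sum_diff:
  fixes G :: "'i::linorder \<Rightarrow> 'i \<Rightarrow> 'b::ab_group_add"
  shows "pair_sum (\<lambda>x y. G x y - G' x y) A = pair_sum G A - pair_sum G' A"
  by (simp add: pair_sum_def sum_subtractf)

text \<open>The position of \<open>a\<close> in the order does not matter: elements below
  \<open>a\<close> meet it in the inner sum of \<open>a\<close>, elements above it in their own
  inner sums, and symmetry turns the latter round.\<close>

lemma pair_sum_insert:
  assumes "finite A" "a \<notin> A" and sym: "\<And>x y. G x y = G y x"
  shows "pair_sum G (insert a A) = pair_sum G A + (\<Sum>y\<in>A. G a y)"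
proof -
  have 1: "(\<Sum>y\<in>{y \<in> insert a A. y < x}. G x y)
      = (\<Sum>y\<in>{y \<in> A. y < x}. G x y) + (if a < x then G a x else 0)" if "x \<in> A" for x
  proof (cases "a < x")
    case True
    then have "{y \<in> insert a A. y < x} = insert a {y \<in> A. y < x}" by auto
    then show ?thesis using True assms by (simp add: add.commute)
  next
    case False
    then have "{y \<in> insert a A. y < x} = {y \<in> A. y < x}" by auto
    then show ?thesis using False by simp
  qed
  have 2: "{y \<in> insert a A. y < a} = {y\<in>A. y < a}" by auto
  have 3: "(\<Sum>y\<in>A. G a y) = (\<Sum>y\<in>{y\<in>A. y < a}. G a y) + (\<Sum>y\<in>{y\<in>A. a < y}. G a y)"
  proof -
    have A: "{y\<in>A. y < a} \<union> {y\<in>A. a < y} = A"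
    proof -
      have "y < a \<or> a < y" if "y \<in> A" for y
        using that assms(2) by (cases y a rule: linorder_cases) auto
      then show ?thesis by blast
    qed
    have "{y\<in>A. y < a} \<inter> {y\<in>A. a < y} = {}" by auto
    then show ?thesis
      using sum.union_disjoint[of "{y\<in>A. y < a}" "{y\<in>A. a < y}" "G a"] assms(1)
      unfolding A by simp
  qed
  have 4: "(\<Sum>x\<in>A. if a < x then G a x else 0) = (\<Sum>y\<in>{y\<in>A. a < y}. G a y)"
    using assms(1) by (simp add: sum.inter_filter)
  have "pair_sum G (insert a A)
      = (\<Sum>y\<in>{y\<in>A. y < a}. G a y) + (\<Sum>x\<in>A. (\<Sum>y\<in>{y \<in> A. y < x}. G x y) + (if a < x then G a x else 0))"
    unfolding pair_sum_def using assms(1,2) 1 2 by (simp cong: sum.cong)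
  also have "\<dots> = pair_sum G A + (\<Sum>y\<in>A. G a y)"
    unfolding sum.distrib 3 4 pair_sum_def by (simp add: ac_simps)
  finally show ?thesis .
qed

text \<open>\<open>\<phi>\<close> need not be monotone, since symmetry absorbs every pair whose
  order it reverses.\<close>

lemma pair_sum_image:
  assumes "finite A" "inj_on \<phi> A" and sym: "\<And>x y. G x y = G y x"
  shows "pair_sum G (\<phi> ` A) = pair_sum (\<lambda>x y. G (\<phi> x) (\<phi> y)) A"
  using assms(1,2)
proof (induction A rule: finite_induct)
  case (insert a A)
  have *: "pair_sum (\<lambda>x y. G (\<phi> x) (\<phi> y)) (insert a A)
      = pair_sum (\<lambda>x y. G (\<phi> x) (\<phi> y)) A + (\<Sum>y\<in>A. G (\<phi> a) (\<phi> y))"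
    using insert.hyps sym by (intro pair_sum_insert) auto
  have "pair_sum G (insert (\<phi> a) (\<phi> ` A)) = pair_sum G (\<phi> ` A) + (\<Sum>y\<in>\<phi> ` A. G (\<phi> a) y)"
    using insert.hyps insert.prems sym by (intro pair_sum_insert) (auto simp: inj_on_def)
  then show ?case
    using insert * by (simp add: sum.reindex)
qed auto

lemma pair_sum_Un:
  assumes "finite A" "finite B" "A \<inter> B = {}" and sym: "\<And>x y. G x y = G y x"
  shows "pair_sum G (A \<union> B) = pair_sum G A + pair_sum G B + (\<Sum>x\<in>A. \<Sum>y\<in>B. G x y)"
  using assms(1,3)
proof (induction A rule: finite_induct)
  case (insert a A)
  have "pair_sum G (insert a (A \<union> B)) = pair_sum G (A \<union> B) + (\<Sum>y\<in>A \<union> B. G a y)"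
    using insert assms(2) sym by (intro pair_sum_insert) auto
  moreover have "(\<Sum>y\<in>A \<union> B. G a y) = (\<Sum>y\<in>A. G a y) + (\<Sum>y\<in>B. G a y)"
    using insert assms(2) by (intro sum.union_disjoint) auto
  moreover have "pair_sum G (insert a A) = pair_sum G A + (\<Sum>y\<in>A. G a y)"
    using insert sym by (intro pair_sum_insert) auto
  ultimately show ?case
    using insert by (simp add: ac_simps)
qed auto

text \<open>A pair lies inside one block or across two; the latter kind is again a sum over pairs,
  now of block indices.\<close>

lemma pair_sum_UN:
  fixes A :: "'j::linorder \<Rightarrow> 'i::linorder set"
  assumes "finite I" "\<And>i. i \<in> I \<Longrightarrow> finite (A i)"
    and disj: "\<And>i j. i \<in> I \<Longrightarrow> j \<in> I \<Longrightarrow> i \<noteq> j \<Longrightarrow> A i \<inter> A j = {}"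
    and sym: "\<And>x y. G x y = G y x"
  shows "pair_sum G (\<Union>i\<in>I. A i)
    = (\<Sum>i\<in>I. pair_sum G (A i)) + pair_sum (\<lambda>i j. \<Sum>x\<in>A i. \<Sum>y\<in>A j. G x y) I"
  using assms(1,2) disj
proof (induction I rule: finite_induct)
  case (insert a I)
  have "pair_sum G (A a \<union> (\<Union>i\<in>I. A i))
      = pair_sum G (A a) + pair_sum G (\<Union>i\<in>I. A i) + (\<Sum>x\<in>A a. \<Sum>y\<in>(\<Union>i\<in>I. A i). G x y)"
  proof (rule pair_sum_Un)
    have "A a \<inter> A i = {}" if "i \<in> I" for i
      using insert.prems(2)[of a i] insert.hyps that by auto
    then show "A a \<inter> (\<Union>i\<in>I. A i) = {}" by blast
  qed (use insert sym in auto)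
  moreover have "(\<Sum>y\<in>(\<Union>i\<in>I. A i). G x y) = (\<Sum>i\<in>I. \<Sum>y\<in>A i. G x y)" for x
    using insert by (intro sum.UNION_disjoint) auto
  moreover have "(\<Sum>x\<in>A a. \<Sum>i\<in>I. \<Sum>y\<in>A i. G x y) = (\<Sum>i\<in>I. \<Sum>x\<in>A a. \<Sum>y\<in>A i. G x y)"
    by (rule sum.swap)
  moreover have "pair_sum (\<lambda>i j. \<Sum>x\<in>A i. \<Sum>y\<in>A j. G x y) (insert a I)
      = pair_sum (\<lambda>i j. \<Sum>x\<in>A i. \<Sum>y\<in>A j. G x y) I + (\<Sum>i\<in>I. \<Sum>x\<in>A a. \<Sum>y\<in>A i. G x y)"
  proof (rule pair_sum_insert)
    show "(\<Sum>x\<in>A i. \<Sum>y\<in>A j. G x y) = (\<Sum>x\<in>A j. \<Sum>y\<in>A i. G x y)" for i j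
      by (subst sum.swap) (simp add: sym)
  qed (use insert in auto)
  ultimately show ?case
    using insert by (simp add: ac_simps)
qed auto

lemma sum_sum_eq_pair_sum:
  assumes "finite A"
  shows "(\<Sum>x\<in>A. \<Sum>y\<in>A. G x y) = (\<Sum>x\<in>A. G x x) + pair_sum (\<lambda>x y. G x y + G y x) A"
  using assms
proof (induction A rule: finite_induct)
  case (insert a A)
  have "pair_sum (\<lambda>x y. G x y + G y x) (insert a A)
      = pair_sum (\<lambda>x y. G x y + G y x) A + (\<Sum>y\<in>A. G a y + G y a)"
    using insert by (intro pair_sum_insert) (auto simp: add.commute)
  then show ?case
    using insert by (simp add: sum.distrib ac_simps)
qed auto

section \<open>Even functions on chains of integers\<close>

text \<open>The elements are the midpoints of the \<open>N\<close> consecutive intervals of length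
  \<open>2 * h\<close> between \<open>e\<close> and \<open>e + 2 * h * int N\<close>, so centred
  differences telescope to these two end points. The step \<open>2 * h\<close> is
  \<open>g\<close>.\<close>

definition chain :: "int \<Rightarrow> int \<Rightarrow> nat \<Rightarrow> int set" where
  "chain h e N = (\<lambda>j. e + h + 2 * h * int j) ` {..<N}"

lemma finite_chain [simp]: "finite (chain h e N)"
  by (simp add: chain_def)

lemma chain_0 [simp]: "chain h e 0 = {}"
  by (simp add: chain_def)

lemma chain_Suc: "chain h e (Suc N) = insert (e + h + 2 * h * int N) (chain h e N)"
  by (simp add: chain_def lessThan_Suc)

lemma chain_fresh: "h > 0 \<Longrightarrow> e + h + 2 * h * int N \<notin> chain h e N"
  by (auto simp: chain_def)

lemma sum_chain_telescope:
  fixes \<phi> :: "int \<Rightarrow> 'b::ab_group_add"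
  assumes "h > 0"
  shows "(\<Sum>x\<in>chain h e N. \<phi> (x + h) - \<phi> (x - h)) = \<phi> (e + 2 * h * int N) - \<phi> e"
proof (induction N)
  case (Suc N)
  have up: "e + h + 2 * h * int N + h = e + 2 * h * int (Suc N)"
    and down: "e + h + 2 * h * int N - h = e + 2 * h * int N"
    by (simp_all add: algebra_simps)
  show ?case
    unfolding chain_Suc sum.insert[OF finite_chain chain_fresh[OF assms]] up down Suc by simp
qed simp

lemma sum_chain_chain_telescope:
  fixes \<Theta> :: "int \<Rightarrow> int \<Rightarrow> 'b::ab_group_add"
  assumes "h > 0"
  defines "G x y \<equiv> \<Theta> (x + h) (y + h) - \<Theta> (x + h) (y - h) - \<Theta> (x - h) (y + h) + \<Theta> (x - h) (y - h)"
  shows "(\<Sum>x\<in>chain h e N. \<Sum>y\<in>chain h e' N'. G x y)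
    = \<Theta> (e + 2 * h * int N) (e' + 2 * h * int N') - \<Theta> (e + 2 * h * int N) e'
      - \<Theta> e (e' + 2 * h * int N') + \<Theta> e e'"
proof -
  have inner: "(\<Sum>y\<in>chain h e' N'. G x y)
      = (\<Theta> (x + h) (e' + 2 * h * int N') - \<Theta> (x + h) e') - (\<Theta> (x - h) (e' + 2 * h * int N') - \<Theta> (x - h) e')"
    for x
    using sum_chain_telescope[OF assms(1), of "\<lambda>b. \<Theta> (x + h) b - \<Theta> (x - h) b" e' N']
    by (simp add: G_def algebra_simps)
  show ?thesis
    unfolding inner sum_chain_telescope[OF assms(1), of "\<lambda>a. \<Theta> a (e' + 2 * h * int N') - \<Theta> a e'" e N]
    by (simp add: algebra_simps)
qed

text \<open>The half-open interval from \<open>- h\<close> to \<open>h\<close> holds one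
  representative of each residue modulo \<open>2 * h\<close>: a multiple of the modulus that is
  smaller in absolute value vanishes.\<close>

lemma central_residue_unique:
  fixes h :: int
  assumes "e + 2 * h * n = e' + 2 * h * n'" "- h < e" "e \<le> h" "- h < e'" "e' \<le> h"
  shows "e = e'"
proof (rule ccontr)
  assume "e \<noteq> e'"
  moreover have eq: "e - e' = (2 * h) * (n' - n)" using assms(1) by (simp add: algebra_simps)
  moreover have "\<bar>e - e'\<bar> < 2 * h" using assms by auto
  ultimately show False
    using zdvd_not_zless[of "\<bar>e - e'\<bar>" "2 * h"]
    by (metis dvd_abs_iff dvd_triv_left zero_less_abs_iff right_minus_eq)
qed

lemma chains_disjoint:
  assumes "e \<noteq> e'" "- h < e" "e \<le> h" "- h < e'" "e' \<le> h"
  shows "chain h e N \<inter> chain h e' N' = {}"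
proof -
  have False if "e + h + 2 * h * int j = e' + h + 2 * h * int j'" for j j'
    using central_residue_unique[of e h "int j" e' "int j'"] that assms by simp
  then show ?thesis by (auto simp: chain_def)
qed

lemma chain_pos: "- h < e \<Longrightarrow> h > 0 \<Longrightarrow> x \<in> chain h e N \<Longrightarrow> x > 0"
  by (auto simp: chain_def intro: add_pos_nonneg)

section \<open>Telescoping calculus for an even function\<close>

locale even_function =
  fixes f :: "int \<Rightarrow> 'b::ab_group_add" and h :: int
  assumes even: "f (- n) = f n" and h_pos: "h > 0"
begin

text \<open>In the application \<open>f\<close> is the logarithm of \<open>\<tau>\<close> on
  absolute values. \<open>D k\<close> is then the joint contribution of two mirror boxes of hook
  length \<open>k\<close>, one shifted by \<open>- g\<close> and the other by
  \<open>g\<close>.\<close>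

definition D :: "int \<Rightarrow> 'b" where
  "D k = (f (k - 2 * h) - f k) + (f (k + 2 * h) - f k)"

definition \<Theta> :: "int \<Rightarrow> int \<Rightarrow> 'b" where
  "\<Theta> a b = f (a + b) + f (a - b)"

text \<open>These window sums are auxiliary: they arise from sums of \<open>D\<close> over an
  interval and from sums of \<open>\<Theta>\<close> over \<open>{0..h}\<close>, and the two
  occurrences cancel at the upper ends of the chains.\<close>

definition W :: "int \<Rightarrow> 'b" where
  "W a = (\<Sum>u\<in>{a - h..a + h}. f u)"

lemma f_minus_commute: "f (a - b) = f (b - a)"
  using even[of "a - b"] by simp

lemma \<Theta>_commute: "\<Theta> a b = \<Theta> b a"
  by (simp add: \<Theta>_def add.commute f_minus_commute[of a b])

lemma \<Theta>_abs: "\<Theta> \<bar>a\<bar> \<bar>b\<bar> = \<Theta> a b"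
proof -
  have "\<Theta> a (- b) = \<Theta> a b" for a b by (simp add: \<Theta>_def add.commute)
  then have "\<Theta> a \<bar>b\<bar> = \<Theta> a b" for a b by (simp add: abs_if)
  then show ?thesis by (metis \<Theta>_commute)
qed

lemma f_abs: "f \<bar>a\<bar> = f a"
  by (simp add: abs_if even)

lemma D_minus: "D (- k) = D k"
  using even[of "k - 2 * h"] even[of "k + 2 * h"] even[of k]
  by (simp add: D_def algebra_simps)

lemma W_Suc: "W (a + 1) - W a = f (a + 1 + h) - f (a - h)"
proof -
  have "{a + 1 - h..a + 1 + h} = insert (a + 1 + h) {a + 1 - h..a + h}"
    "{a - h..a + h} = insert (a - h) {a + 1 - h..a + h}"
    using h_pos by auto
  then show ?thesis by (simp add: W_def algebra_simps)
qed

lemma W_minus: "W (- a) = W a"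
proof -
  show ?thesis
    unfolding W_def
    by (rule sum.reindex_bij_witness[of _ uminus uminus]) (auto simp: even)
qed

text \<open>The sum runs up to \<open>n\<close>, so that the induction can start at 0, where both
  sides vanish by evenness. In each step the two windows move by one, which changes only their end
  terms.\<close>

lemma sum_D_step:
  "(\<Sum>k\<in>{1..int n}. D k) + f (int n) - f (int n - 2 * h) + f (2 * h) - f 0
    = W (int n + h) - W (int n - h)"
proof (induction n)
  case 0
  then show ?case using W_minus[of h] even[of "2*h"] by simp
next
  case (Suc n)
  have "{1..int (Suc n)} = insert (int n + 1) {1..int n}" by auto
  then have 1: "(\<Sum>k\<in>{1..int (Suc n)}. D k) = D (int n + 1) + (\<Sum>k\<in>{1..int n}. D k)" by simp
  have 2: "W (int (Suc n) + h) = W (int n + h) + f (int n + 1 + 2 * h) - f (int n)"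
    using W_Suc[of "int n + h"] by (simp add: algebra_simps)
  have 3: "W (int (Suc n) - h) = W (int n - h) + f (int n + 1) - f (int n - 2 * h)"
    using W_Suc[of "int n - h"] by (simp add: algebra_simps)
  have "W (int (Suc n) + h) - W (int (Suc n) - h)
     = ((\<Sum>k\<in>{1..int n}. D k) + f (int n) - f (int n - 2 * h) + f (2 * h) - f 0)
       + f (int n + 1 + 2 * h) - f (int n) - (f (int n + 1) - f (int n - 2 * h))"
    unfolding Suc 2 3 by (simp add: algebra_simps)
  then show ?case
    unfolding 1 by (simp add: D_def algebra_simps)
qed

text \<open>Absorbing \<open>D x\<close> turns the end terms of \<open>sum_D_step\<close> into
  \<open>f (x + 2 * h) - f x\<close>, the contribution of the box \<open>(0, - x)\<close> of hook
  length \<open>x\<close>.\<close>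

lemma sum_D:
  assumes "x > 0"
  shows "(\<Sum>k\<in>{1..x - 1}. D k) + f (x + 2 * h) - f x + f (2 * h) - f 0 = W (x + h) - W (x - h)"
proof -
  have "{1..x} = insert x {1..x - 1}" using assms by auto
  then have 1: "(\<Sum>k\<in>{1..x}. D k) = D x + (\<Sum>k\<in>{1..x - 1}. D k)" by simp
  have "W (x + h) - W (x - h)
      = D x + (\<Sum>k\<in>{1..x - 1}. D k) + f x - f (x - 2 * h) + f (2 * h) - f 0"
    using sum_D_step[of "nat x"] assms by (simp add: 1)
  then show ?thesis
    by (simp add: D_def[of x] algebra_simps)
qed

text \<open>The arguments \<open>a + b\<close> and \<open>a - b\<close> cover the window around
  \<open>a\<close> once, except for its centre, which is met twice at \<open>b = 0\<close>.\<close>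

lemma sum_\<Theta>: "(\<Sum>b\<in>{0..h}. \<Theta> a b) = W a + f a"
proof -
  have 1: "(\<Sum>b\<in>{0..h}. f (a + b)) = (\<Sum>u\<in>{a..a + h}. f u)"
    by (rule sum.reindex_bij_witness[of _ "\<lambda>u. u - a" "\<lambda>b. a + b"]) auto
  have 2: "(\<Sum>b\<in>{0..h}. f (a - b)) = (\<Sum>u\<in>{a - h..a}. f u)"
    by (rule sum.reindex_bij_witness[of _ "\<lambda>u. a - u" "\<lambda>b. a - b"]) auto
  have "{a..a + h} = insert a {a + 1..a + h}" using h_pos by auto
  then have 3: "(\<Sum>u\<in>{a..a + h}. f u) = f a + (\<Sum>u\<in>{a + 1..a + h}. f u)" by simp
  have "{a - h..a + h} = {a - h..a} \<union> {a + 1..a + h}" using h_pos by auto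
  then have 4: "W a = (\<Sum>u\<in>{a - h..a}. f u) + (\<Sum>u\<in>{a + 1..a + h}. f u)"
    unfolding W_def by (simp add: sum.union_disjoint)
  show ?thesis
    unfolding \<Theta>_def sum.distrib 1 2 3 4 by (simp add: algebra_simps)
qed

text \<open>\<open>D (x + y) - D (x - y)\<close> is a mixed second difference, which is why it telescopes along
  two chains at once.\<close>

lemma D_mixed_difference:
  "D (x + y) - D (x - y)
    = \<Theta> (x + h) (y + h) - \<Theta> (x + h) (y - h) - \<Theta> (x - h) (y + h) + \<Theta> (x - h) (y - h)"
  by (simp add: D_def \<Theta>_def algebra_simps)

text \<open>The terms \<open>f (2 * x + 2 * h) - f (2 * x)\<close> come from the boxes
  \<open>(x, - x)\<close>, and \<open>f 0 - f (2 * h)\<close> is the correction left by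
  \<open>sum_D\<close>. With them the pairs inside one chain telescope as well: at each insertion
  they reduce the corner terms \<open>\<Theta> (r + 2 * h) r - \<Theta> r r\<close> to
  \<open>f (2 * (r + 2 * h)) - f (2 * r)\<close>.\<close>

lemma pair_sum_within_chain:
  "pair_sum (\<lambda>x y. D (x + y) - D (x - y)) (chain h e N)
      + (\<Sum>x\<in>chain h e N. f (2 * x + 2 * h) - f (2 * x) - f (2 * h) + f 0)
    = f (2 * (e + 2 * h * int N)) - \<Theta> (e + 2 * h * int N) e + f 0"
proof (induction N)
  case 0
  then show ?case by (simp add: \<Theta>_def)
next
  case (Suc N)
  define r where "r = e + 2 * h * int N"
  have x: "e + h + 2 * h * int N = r + h" and r': "e + 2 * h * int (Suc N) = r + 2 * h"
    by (simp_all add: r_def algebra_simps)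
  have fresh: "r + h \<notin> chain h e N" using chain_fresh[OF h_pos, of e N] x by simp
  have "pair_sum (\<lambda>x y. D (x + y) - D (x - y)) (insert (r + h) (chain h e N))
      = pair_sum (\<lambda>x y. D (x + y) - D (x - y)) (chain h e N)
        + (\<Sum>y\<in>chain h e N. D (r + h + y) - D (r + h - y))"
  proof (rule pair_sum_insert[OF finite_chain fresh])
    show "D (x + y) - D (x - y) = D (y + x) - D (y - x)" for x y
      using D_minus[of "x - y"] by (simp add: add.commute)
  qed
  moreover have "(\<Sum>y\<in>chain h e N. D (r + h + y) - D (r + h - y))
      = (\<Theta> (r + 2 * h) r - \<Theta> r r) - (\<Theta> (r + 2 * h) e - \<Theta> r e)"
  proof -
    have "D (r + h + y) - D (r + h - y)
        = (\<Theta> (r + 2 * h) (y + h) - \<Theta> r (y + h)) - (\<Theta> (r + 2 * h) (y - h) - \<Theta> r (y - h))" for y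
      unfolding D_mixed_difference by (simp add: algebra_simps)
    then show ?thesis
      using sum_chain_telescope[OF h_pos, of "\<lambda>b. \<Theta> (r + 2 * h) b - \<Theta> r b" e N]
      by (simp add: r_def)
  qed
  ultimately have "pair_sum (\<lambda>x y. D (x + y) - D (x - y)) (insert (r + h) (chain h e N))
       + (\<Sum>x\<in>insert (r + h) (chain h e N). f (2 * x + 2 * h) - f (2 * x) - f (2 * h) + f 0)
     = (pair_sum (\<lambda>x y. D (x + y) - D (x - y)) (chain h e N)
        + (\<Sum>x\<in>chain h e N. f (2 * x + 2 * h) - f (2 * x) - f (2 * h) + f 0))
       + ((\<Theta> (r + 2 * h) r - \<Theta> r r) - (\<Theta> (r + 2 * h) e - \<Theta> r e))
       + (f (2 * (r + h) + 2 * h) - f (2 * (r + h)) - f (2 * h) + f 0)"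
    using fresh by (simp add: algebra_simps)
  also have "\<dots> = (f (2 * r) - \<Theta> r e + f 0)
       + ((\<Theta> (r + 2 * h) r - \<Theta> r r) - (\<Theta> (r + 2 * h) e - \<Theta> r e))
       + (f (2 * (r + h) + 2 * h) - f (2 * (r + h)) - f (2 * h) + f 0)"
    using Suc by (simp add: r_def)
  also have "\<dots> = f (2 * (r + 2 * h)) - \<Theta> (r + 2 * h) e + f 0"
    by (simp add: \<Theta>_def algebra_simps)
  finally show ?case
    unfolding chain_Suc x r' .
qed

text \<open>The left side is the shape taken by the sum over all boxes. Single terms telescope
  through \<open>W\<close>, pairs through \<open>\<Theta>\<close>. Since the
  \<open>\<bar>e i\<bar>\<close> run over \<open>{0..h}\<close>, the mixed terms
  \<open>\<Theta> (r i) (e j)\<close> add up to windows again, and these cancel the windows from the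
  single terms.\<close>

theorem chains_identity:
  fixes I :: "'i::linorder set" and N :: "'i \<Rightarrow> nat" and e :: "'i \<Rightarrow> int"
  assumes "finite I" and bij: "bij_betw (\<lambda>i. \<bar>e i\<bar>) I {0..h}" and e_gt: "\<And>i. i \<in> I \<Longrightarrow> - h < e i"
  defines "P \<equiv> (\<Union>i\<in>I. chain h (e i) (N i))" and "r \<equiv> \<lambda>i. e i + 2 * h * int (N i)"
  shows "(\<Sum>x\<in>P. (f (2 * x + 2 * h) - f (2 * x)) + (f (x + 2 * h) - f x) + (\<Sum>k\<in>{1..x - 1}. D k))
      + pair_sum (\<lambda>x y. D (x + y) - D (x - y)) P
    = (\<Sum>i\<in>I. f (2 * r i) - f (r i)) + (\<Sum>a\<in>{0..h}. f a - f (2 * a))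
      + pair_sum (\<lambda>i j. \<Theta> (r i) (r j)) I - pair_sum \<Theta> {0..h}"
proof -
  define C where "C i = chain h (e i) (N i)" for i
  have e_le: "e i \<le> h" if "i \<in> I" for i
    using bij_betwE[OF bij] that by (force simp: abs_if split: if_splits)
  have e_inj: "e i \<noteq> e j" if "i \<in> I" "j \<in> I" "i \<noteq> j" for i j
    using bij_betw_imp_inj_on[OF bij] that by (auto simp: inj_on_def)
  have disj: "C i \<inter> C j = {}" if "i \<in> I" "j \<in> I" "i \<noteq> j" for i j
    unfolding C_def using chains_disjoint[OF e_inj] e_gt e_le that by blast
  have sumP: "(\<Sum>x\<in>P. F x) = (\<Sum>i\<in>I. \<Sum>x\<in>C i. F x)" for F :: "int \<Rightarrow> 'b"
    unfolding P_def C_def[symmetric] using assms(1) disj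
    by (intro sum.UNION_disjoint) (auto simp: C_def)
  have pairP: "pair_sum (\<lambda>x y. D (x + y) - D (x - y)) P
      = (\<Sum>i\<in>I. pair_sum (\<lambda>x y. D (x + y) - D (x - y)) (C i))
        + pair_sum (\<lambda>i j. \<Sum>x\<in>C i. \<Sum>y\<in>C j. D (x + y) - D (x - y)) I"
    unfolding P_def C_def[symmetric]
  proof (rule pair_sum_UN[OF assms(1)])
    show "D (x + y) - D (x - y) = D (y + x) - D (y - x)" for x y
      using D_minus[of "x - y"] by (simp add: add.commute)
  qed (use disj in \<open>auto simp: C_def\<close>)
  have CC: "(\<Sum>x\<in>C i. \<Sum>y\<in>C j. D (x + y) - D (x - y))
      = \<Theta> (r i) (r j) + \<Theta> (e i) (e j) - (\<Theta> (r i) (e j) + \<Theta> (r j) (e i))" for i j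
    unfolding D_mixed_difference C_def sum_chain_chain_telescope[OF h_pos] r_def[symmetric]
    by (simp add: r_def \<Theta>_commute[of "e i"] algebra_simps)
  have single: "(f (2 * x + 2 * h) - f (2 * x)) + (f (x + 2 * h) - f x) + (\<Sum>k\<in>{1..x - 1}. D k)
      = (W (x + h) - W (x - h)) + (f (2 * x + 2 * h) - f (2 * x) - f (2 * h) + f 0)"
    if "x \<in> C i" "i \<in> I" for x i
    unfolding sum_D[OF chain_pos[OF e_gt[OF that(2)] h_pos that(1)[unfolded C_def]], symmetric]
    by (simp add: algebra_simps)
  have W_chain: "(\<Sum>x\<in>C i. W (x + h) - W (x - h)) = W (r i) - W (e i)" for i
    unfolding C_def sum_chain_telescope[OF h_pos] r_def ..
  have within: "(\<Sum>x\<in>C i. f (2 * x + 2 * h) - f (2 * x) - f (2 * h) + f 0)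
      = f (2 * r i) - \<Theta> (r i) (e i) + f 0 - pair_sum (\<lambda>x y. D (x + y) - D (x - y)) (C i)" for i
    using pair_sum_within_chain[of "e i" "N i"] unfolding C_def r_def
    by (simp add: algebra_simps)
  have sum_e: "(\<Sum>i\<in>I. F \<bar>e i\<bar>) = (\<Sum>a\<in>{0..h}. F a)" for F :: "int \<Rightarrow> 'b"
    using sum.reindex_bij_betw[OF bij, of F] by simp
  have \<Theta>_abs': "\<Theta> a \<bar>b\<bar> = \<Theta> a b" for a b by (metis \<Theta>_abs abs_idempotent)
  have row: "(\<Sum>j\<in>I. \<Theta> a (e j)) = W a + f a" for a
    using sum_e[of "\<Theta> a"] sum_\<Theta>[of a] by (simp add: \<Theta>_abs')
  \<comment> \<open>Completing the mixed terms to a full double sum makes the row sums usable; the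
    diagonal \<open>\<Theta> (r i) (e i)\<close> paid for this cancels against the one in
    \<open>within\<close>.\<close>
  have re: "pair_sum (\<lambda>i j. \<Theta> (r i) (e j) + \<Theta> (r j) (e i)) I
      = (\<Sum>i\<in>I. W (r i) + f (r i)) - (\<Sum>i\<in>I. \<Theta> (r i) (e i))"
    using sum_sum_eq_pair_sum[OF assms(1), of "\<lambda>i j. \<Theta> (r i) (e j)"] by (simp add: row)
  define K where "K = pair_sum (\<lambda>i j. \<Theta> (e i) (e j)) I"
  \<comment> \<open>Counting the double sum of \<open>\<Theta> (e i) (e j)\<close> by rows and by
    pairs expresses the sum of the \<open>W (e i)\<close> through \<open>f\<close> and
    \<open>K\<close>, without evaluating any single window.\<close>
  have ee: "(\<Sum>i\<in>I. W (e i) + f (e i)) = (\<Sum>i\<in>I. f (2 * e i) + f 0) + (K + K)"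
    using sum_sum_eq_pair_sum[OF assms(1), of "\<lambda>i j. \<Theta> (e i) (e j)"]
    by (simp add: row K_def pair_sum_add \<Theta>_commute[of "e j" "e i" for i j]) (simp add: \<Theta>_def)
  have K: "K = pair_sum \<Theta> {0..h}"
    using pair_sum_image[OF assms(1) bij_betw_imp_inj_on[OF bij], of \<Theta>]
    by (simp add: K_def bij_betw_imp_surj_on[OF bij] \<Theta>_commute \<Theta>_abs)
  have fe: "(\<Sum>i\<in>I. f (e i)) = (\<Sum>a\<in>{0..h}. f a)" 
    using sum_e[of f] by (simp add: f_abs)
  have f2e: "(\<Sum>i\<in>I. f (2 * e i)) = (\<Sum>a\<in>{0..h}. f (2 * a))"
    using sum_e[of "\<lambda>a. f (2 * a)"] f_abs[of "2 * e i" for i] by (simp add: abs_mult)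
  have We: "(\<Sum>i\<in>I. W (e i)) = (\<Sum>i\<in>I. f 0) + (\<Sum>a\<in>{0..h}. f (2 * a)) - (\<Sum>a\<in>{0..h}. f a) + K + K"
    using ee unfolding sum.distrib fe f2e by (simp add: algebra_simps)
  have P1: "(\<Sum>x\<in>P. (f (2 * x + 2 * h) - f (2 * x)) + (f (x + 2 * h) - f x) + (\<Sum>k\<in>{1..x - 1}. D k))
      = (\<Sum>i\<in>I. (W (r i) - W (e i)) + (f (2 * r i) - \<Theta> (r i) (e i) + f 0
           - pair_sum (\<lambda>x y. D (x + y) - D (x - y)) (C i)))"
    unfolding sumP within[symmetric] W_chain[symmetric] sum.distrib[symmetric]
    by (intro sum.cong refl) (simp add: single)
  have P2: "pair_sum (\<lambda>i j. \<Sum>x\<in>C i. \<Sum>y\<in>C j. D (x + y) - D (x - y)) I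
      = pair_sum (\<lambda>i j. \<Theta> (r i) (r j)) I + K - ((\<Sum>i\<in>I. W (r i) + f (r i)) - (\<Sum>i\<in>I. \<Theta> (r i) (e i)))"
    unfolding CC K_def re[symmetric] by (simp add: pair_sum_add pair_sum_diff)
  show ?thesis
    unfolding P1 pairP P2 K[symmetric]
    by (simp add: sum.distrib sum_subtractf We algebra_simps)
qed

end

section \<open>Symmetric sets of integers\<close>

locale symmetric_set =
  fixes X :: "int set"
  assumes zero_mem: "0 \<in> X" and mem_minus: "z \<noteq> 0 \<Longrightarrow> - z \<in> X \<longleftrightarrow> z \<notin> X"
    and finite_pos: "finite {x \<in> X. 0 < x}"
begin

definition P :: "int set" where
  "P = {x \<in> X. 0 < x}"

definition H :: "(int \<times> int) set" where
  "H = {(x, y). x \<in> X \<and> y \<notin> X \<and> y < x}"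

text \<open>These are the boxes strictly above the diagonal: \<open>y < x\<close> and
  \<open>0 < x + y\<close> force \<open>x\<close> to be positive.\<close>

definition Hpos :: "(int \<times> int) set" where
  "Hpos = (SIGMA x:P. {- x<..<x} - X)"

lemma finite_P: "finite P"
  using finite_pos by (simp add: P_def)

lemma finite_Hpos: "finite Hpos"
  by (simp add: Hpos_def finite_P)

text \<open>The reflection from \<open>(x, y)\<close> to \<open>(- y, - x)\<close> preserves hook
  lengths and matches the boxes above the diagonal with those below it, apart from the boxes of the
  bead 0. For a partition, the boxes \<open>(x, - x)\<close> form the diagonal and the boxes
  \<open>(0, - x)\<close> the surplus row just below the Durfee square.\<close>

lemma H_split:
  "H = Hpos \<union> (\<lambda>(x, y). (- y, - x)) ` Hpos \<union> (\<lambda>x. (x, - x)) ` P \<union> (\<lambda>x. (0, - x)) ` P"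
proof (intro equalityI subsetI)
  fix p assume "p \<in> H"
  then obtain x y where p: "p = (x, y)" "x \<in> X" "y \<notin> X" "y < x" by (auto simp: H_def)
  have y0: "y \<noteq> 0" using p zero_mem by auto
  have y: "- y \<in> X" using mem_minus[OF y0] p by simp
  consider "x + y > 0" | "x + y = 0" | "x = 0" | "x + y < 0" "x \<noteq> 0" by linarith
  then show "p \<in> Hpos \<union> (\<lambda>(x, y). (- y, - x)) ` Hpos \<union> (\<lambda>x. (x, - x)) ` P \<union> (\<lambda>x. (0, - x)) ` P"
  proof cases
    case 1
    then have "p \<in> Hpos" using p by (auto simp: Hpos_def P_def)
    then show ?thesis by blast
  next
    case 2
    then have "y = - x" "x > 0" using p by auto
    then have "p \<in> (\<lambda>x. (x, - x)) ` P" using p by (auto simp: P_def)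
    then show ?thesis by blast
  next
    case 3
    then have "p = (\<lambda>x. (0, - x)) (- y)" "- y \<in> P" using p y by (auto simp: P_def)
    then have "p \<in> (\<lambda>x. (0, - x)) ` P" by blast
    then show ?thesis by blast
  next
    case 4
    then have "(- y, - x) \<in> Hpos" using p y mem_minus[OF 4(2)] by (auto simp: Hpos_def P_def)
    moreover have "p = (\<lambda>(x, y). (- y, - x)) (- y, - x)" using p by simp
    ultimately show ?thesis by blast
  qed
next
  fix p
  assume "p \<in> Hpos \<union> (\<lambda>(x, y). (- y, - x)) ` Hpos \<union> (\<lambda>x. (x, - x)) ` P \<union> (\<lambda>x. (0, - x)) ` P"
  then consider "p \<in> Hpos" | x y where "(x, y) \<in> Hpos" "p = (- y, - x)"
    | x where "x \<in> P" "p = (x, - x)" | x where "x \<in> P" "p = (0, - x)" by auto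
  then show "p \<in> H"
  proof cases
    case (2 x y)
    then have "y \<noteq> 0" "x \<noteq> 0" using zero_mem by (auto simp: Hpos_def P_def)
    then show ?thesis using 2 mem_minus by (auto simp: H_def Hpos_def P_def)
  qed (use mem_minus zero_mem in \<open>auto simp: H_def Hpos_def P_def\<close>)
qed

lemma finite_H: "finite H"
  unfolding H_split using finite_Hpos finite_P by blast

lemma Hpos_sum_pos: "(x, y) \<in> Hpos \<Longrightarrow> 0 < x + y"
  by (auto simp: Hpos_def)

text \<open>For fixed \<open>x\<close>, start from all of \<open>{1..x - 1}\<close> as gaps. Each
  smaller positive bead \<open>y\<close> removes the gap \<open>y\<close> and creates the gap
  \<open>- y\<close>, which replaces the hook length \<open>x - y\<close> by
  \<open>x + y\<close>.\<close>

lemma sum_Hpos: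
  fixes u :: "int \<Rightarrow> 'b::ab_group_add"
  shows "(\<Sum>(x, y)\<in>Hpos. u (x - y))
    = (\<Sum>x\<in>P. \<Sum>k\<in>{1..x - 1}. u k) + pair_sum (\<lambda>x y. u (x + y) - u (x - y)) P"
proof -
  have "(\<Sum>y\<in>{- x<..<x} - X. u (x - y))
      = (\<Sum>k\<in>{1..x - 1}. u k) + (\<Sum>y\<in>{y \<in> P. y < x}. u (x + y) - u (x - y))" if x: "x \<in> P" for x
  proof -
    have fin: "finite {y \<in> P. y < x}" using finite_P by simp
    have split: "{- x<..<x} - X = ({1..x - 1} - {y \<in> P. y < x}) \<union> uminus ` {y \<in> P. y < x}"
    proof (intro equalityI subsetI)
      fix y assume y: "y \<in> {- x<..<x} - X"
      then have "y \<noteq> 0" using zero_mem by auto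
      show "y \<in> ({1..x - 1} - {y \<in> P. y < x}) \<union> uminus ` {y \<in> P. y < x}"
      proof (cases "y > 0")
        case True
        then show ?thesis using y by (auto simp: P_def)
      next
        case False
        then have "- y \<in> {y \<in> P. y < x}" using y mem_minus[OF \<open>y \<noteq> 0\<close>] \<open>y \<noteq> 0\<close> by (auto simp: P_def)
        then have "y \<in> uminus ` {y \<in> P. y < x}" by force
        then show ?thesis by blast
      qed
    next
      fix y assume "y \<in> ({1..x - 1} - {y \<in> P. y < x}) \<union> uminus ` {y \<in> P. y < x}"
      then consider "y \<in> {1..x - 1}" "y \<notin> {y \<in> P. y < x}" | z where "z \<in> P" "z < x" "y = - z"
        by auto
      then show "y \<in> {- x<..<x} - X"
      proof cases
        case 2
        then show ?thesis using mem_minus[of z] by (auto simp: P_def)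
      qed (auto simp: P_def)
    qed
    have disj: "({1..x - 1} - {y \<in> P. y < x}) \<inter> uminus ` {y \<in> P. y < x} = {}"
      by (auto simp: P_def)
    have refl: "(\<Sum>y\<in>{1..x - 1}. u (x - y)) = (\<Sum>k\<in>{1..x - 1}. u k)"
      by (rule sum.reindex_bij_witness[of _ "\<lambda>k. x - k" "\<lambda>k. x - k"]) auto
    have sub: "(\<Sum>y\<in>{1..x - 1} - {y \<in> P. y < x}. u (x - y))
        = (\<Sum>k\<in>{1..x - 1}. u k) - (\<Sum>y\<in>{y \<in> P. y < x}. u (x - y))"
      unfolding refl[symmetric] by (rule sum_diff) (auto simp: P_def)
    have neg: "(\<Sum>y\<in>uminus ` {y \<in> P. y < x}. u (x - y)) = (\<Sum>y\<in>{y \<in> P. y < x}. u (x + y))"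
      by (subst sum.reindex) auto
    have "(\<Sum>y\<in>{- x<..<x} - X. u (x - y))
        = (\<Sum>y\<in>{1..x - 1} - {y \<in> P. y < x}. u (x - y)) + (\<Sum>y\<in>uminus ` {y \<in> P. y < x}. u (x - y))"
      unfolding split using fin disj by (intro sum.union_disjoint) auto
    then show ?thesis
      unfolding sub neg sum_subtractf by (simp add: algebra_simps)
  qed
  moreover have "(\<Sum>(x, y)\<in>Hpos. u (x - y)) = (\<Sum>x\<in>P. \<Sum>y\<in>{- x<..<x} - X. u (x - y))"
    unfolding Hpos_def by (subst sum.Sigma) (auto simp: finite_P)
  ultimately show ?thesis
    by (simp add: pair_sum_def sum.distrib)
qed

text \<open>The flag of \<open>w\<close> says whether a box is strictly above the diagonal. Mirror
  boxes contribute one value for each flag; diagonal and surplus boxes have hook lengths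
  \<open>2 * x\<close> and \<open>x\<close>, both with flag \<open>False\<close>.\<close>

theorem sum_H:
  fixes w :: "bool \<Rightarrow> int \<Rightarrow> 'b::ab_group_add"
  shows "(\<Sum>(x, y)\<in>H. w (0 < x + y) (x - y))
    = (\<Sum>x\<in>P. w False (2 * x) + w False x + (\<Sum>k\<in>{1..x - 1}. w True k + w False k))
      + pair_sum (\<lambda>x y. (w True (x + y) + w False (x + y)) - (w True (x - y) + w False (x - y))) P"
proof -
  define F where "F p = (case p of (x, y) \<Rightarrow> w (0 < x + y) (x - y))" for p :: "int \<times> int"
  have "sum F H = sum F Hpos + sum F ((\<lambda>(x, y). (- y, - x)) ` Hpos)
      + sum F ((\<lambda>x. (x, - x)) ` P) + sum F ((\<lambda>x. (0, - x)) ` P)"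
    unfolding H_split
  proof (subst sum.union_disjoint, goal_cases)
    case 4
    show ?case
    proof (subst sum.union_disjoint, goal_cases)
      case 4
      show ?case
        by (subst sum.union_disjoint) (use finite_P finite_Hpos in \<open>auto simp: Hpos_def\<close>)
    qed (use finite_P finite_Hpos in \<open>auto simp: Hpos_def\<close>)
  next
    case 3
    then show ?case using zero_mem by (auto simp: Hpos_def P_def)
  qed (use finite_P finite_Hpos in auto)
  moreover have "sum F Hpos = (\<Sum>(x, y)\<in>Hpos. w True (x - y))"
    by (intro sum.cong) (auto simp: F_def Hpos_sum_pos)
  moreover have "sum F ((\<lambda>(x, y). (- y, - x)) ` Hpos) = (\<Sum>(x, y)\<in>Hpos. w False (x - y))"
    by (subst sum.reindex)
      (auto simp: F_def inj_on_def add.commute intro!: sum.cong dest!: Hpos_sum_pos)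
  moreover have "sum F ((\<lambda>x. (x, - x)) ` P) = (\<Sum>x\<in>P. w False (2 * x))"
    by (subst sum.reindex) (auto simp: F_def inj_on_def)
  moreover have "sum F ((\<lambda>x. (0, - x)) ` P) = (\<Sum>x\<in>P. w False x)"
    by (subst sum.reindex) (auto simp: F_def inj_on_def P_def intro!: sum.cong)
  moreover have "sum F H = (\<Sum>(x, y)\<in>H. w (0 < x + y) (x - y))"
    by (simp add: F_def)
  ultimately show ?thesis
    by (simp add: sum_Hpos sum.distrib pair_sum_add pair_sum_diff)
qed

text \<open>For constant weight 1 the pair terms vanish, and \<open>x\<close> accounts for 1 + 1 +
  2(x - 1) boxes.\<close>

lemma card_H: "int (card H) = (\<Sum>x\<in>P. 2 * x)"
proof -
  have "(\<Sum>(x, y)\<in>H. 1::int) = (\<Sum>x\<in>P. 2 * x)"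
    using sum_H[of "\<lambda>_ _. 1::int"] by (auto simp: pair_sum_def P_def intro!: sum.cong)
  then show ?thesis by (simp add: case_prod_beta)
qed

end

lemma sum_double_chain:
  assumes "h > 0"
  shows "2 * h * (\<Sum>x\<in>chain h e N. 2 * x) = (e + 2 * h * int N)\<^sup>2 - e\<^sup>2"
  using sum_chain_telescope[OF assms, of "\<lambda>x. x\<^sup>2" e N]
  by (simp add: sum_distrib_left power2_eq_square algebra_simps)

section \<open>Partitions and their bead sets\<close>

text \<open>Both sides of \<open>conj\<close> say that the box \<open>(i, j)\<close> lies in the
  diagram. Treating rows and columns alike makes each fact about rows available for columns through
  \<open>sym\<close>.\<close>

locale conjugate =
  fixes p q :: "nat \<Rightarrow> nat"
  assumes conj: "1 \<le> i \<Longrightarrow> 1 \<le> j \<Longrightarrow> j \<le> p i \<longleftrightarrow> i \<le> q j"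
begin

lemma sym: "conjugate q p"
  by unfold_locales (simp add: conj)

lemma antimono:
  assumes "1 \<le> i" "i \<le> i'"
  shows "p i' \<le> p i"
proof (cases "p i' = 0")
  case False
  then have "i' \<le> q (p i')" using conj[of i' "p i'"] assms by simp
  then show ?thesis using conj[of i "p i'"] assms False by simp
qed simp

text \<open>Contents are shifted by one so that the symmetry of \<open>DD'\<close> becomes \<open>z \<mapsto> - z\<close>;
  \<open>gap\<close> enumerates the complement of the set of beads.\<close>

definition bead :: "nat \<Rightarrow> int" where "bead i = int (p i) - int i + 1"

definition gap :: "nat \<Rightarrow> int" where "gap j = int j - int (q j)"

definition X :: "int set" where "X = bead ` {1..}"

lemma gap_less_bead_iff: "1 \<le> i \<Longrightarrow> 1 \<le> j \<Longrightarrow> gap j < bead i \<longleftrightarrow> j \<le> p i"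
  using conj[of i j] by (auto simp: bead_def gap_def)

lemma bead_neq_gap: "1 \<le> i \<Longrightarrow> 1 \<le> j \<Longrightarrow> bead i \<noteq> gap j"
  using conj[of i j] by (cases "j \<le> p i") (auto simp: bead_def gap_def)

lemma bead_strict_antimono: "1 \<le> i \<Longrightarrow> i < i' \<Longrightarrow> bead i' < bead i"
  using antimono[of i i'] by (simp add: bead_def)

lemma bead_less_iff: "1 \<le> i \<Longrightarrow> 1 \<le> i' \<Longrightarrow> bead i' < bead i \<longleftrightarrow> i < i'"
  by (metis less_asym linorder_neqE_nat bead_strict_antimono)

lemma gap_strict_mono: "1 \<le> j \<Longrightarrow> j < j' \<Longrightarrow> gap j < gap j'"
  using conjugate.antimono[OF sym, of j j'] by (simp add: gap_def)

lemma inj_bead: "inj_on bead {1..}"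
  by (rule linorder_inj_onI) (use bead_strict_antimono in force)+

lemma inj_gap: "inj_on gap {1..}"
  by (rule linorder_inj_onI) (use gap_strict_mono in force)+

text \<open>Beads and gaps partition the integers: if \<open>z\<close> is no bead, take the first
  row \<open>i\<close> whose bead is below \<open>z\<close>; the column that reaches content
  \<open>z\<close> in this row ends exactly in row \<open>i - 1\<close>.\<close>

lemma not_mem_X_iff: "z \<notin> X \<longleftrightarrow> z \<in> gap ` {1..}"
proof
  assume z: "z \<notin> X"
  have ex: "\<exists>i. 1 \<le> i \<and> bead i \<le> z"
  proof (intro exI conjI)
    \<comment> \<open>The row number is so large that the bead is at most \<open>z\<close> even for
      a row of the maximal length \<open>p 1\<close>.\<close>
    show "1 \<le> Suc (p 1 + nat (- z))" by simp
    have "p (Suc (p 1 + nat (- z))) \<le> p 1" by (rule antimono) auto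
    then have "int (p (Suc (p 1 + nat (- z)))) \<le> int (p 1)" by (simp only: of_nat_le_iff)
    then show "bead (Suc (p 1 + nat (- z))) \<le> z"
      unfolding bead_def of_nat_Suc of_nat_add by linarith
  qed
  define i where "i = (LEAST i. 1 \<le> i \<and> bead i \<le> z)"
  have i: "1 \<le> i" "bead i \<le> z" using LeastI_ex[OF ex] by (auto simp: i_def)
  then have xi: "bead i < z" using z by (force simp: X_def)
  have prev: "bead i' > z" if "1 \<le> i'" "i' < i" for i'
    using not_less_Least[of i' "\<lambda>i. 1 \<le> i \<and> bead i \<le> z"] that by (auto simp: i_def)
  \<comment> \<open>Solves \<open>gap j = z\<close> under the expected value
    \<open>q j = i - 1\<close>.\<close>
  define j where "j = nat (z + int i - 1)"
  have j: "int j = z + int i - 1" "1 \<le> j" using xi i by (auto simp: j_def bead_def)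
  have "\<not> j \<le> p i" using xi j by (simp add: bead_def)
  then have 1: "q j < i" using conj[of i j] i j by simp
  have 2: "i - 1 \<le> q j"
  proof (cases "i = 1")
    case False
    then have "bead (i - 1) > z" using i by (intro prev) auto
    then have "j \<le> p (i - 1)" using j i False by (simp add: bead_def)
    then show ?thesis using conj[of "i - 1" j] i False j by simp
  qed simp
  have "int (q j) = int i - 1" using 1 2 i by auto
  then have "gap j = z" using j by (simp add: gap_def)
  then show "z \<in> gap ` {1..}" using j by auto
next
  assume "z \<in> gap ` {1..}"
  then show "z \<notin> X" using bead_neq_gap by (fastforce simp: X_def)
qed

lemma finite_X_pos: "finite {z \<in> X. 0 < z}"
proof -
  have "z \<le> bead 1" if z: "z \<in> X" for z
  proof -
    obtain i where i: "z = bead i" "1 \<le> i" using z by (auto simp: X_def)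
    then show ?thesis using bead_strict_antimono[of 1 i] by (cases "i = 1") simp_all
  qed
  then have "{z \<in> X. 0 < z} \<subseteq> {0..bead 1}" by auto
  then show ?thesis by (rule finite_subset) simp
qed

lemma bij_betw_boxes:
  "bij_betw (\<lambda>(i, j). (bead i, gap j)) {(i, j). 1 \<le> i \<and> 1 \<le> j \<and> j \<le> p i}
    {(a, b). a \<in> X \<and> b \<notin> X \<and> b < a}"
proof (rule bij_betw_imageI)
  show "inj_on (\<lambda>(i, j). (bead i, gap j)) {(i, j). 1 \<le> i \<and> 1 \<le> j \<and> j \<le> p i}"
    using inj_bead inj_gap by (auto simp: inj_on_def)
  show "(\<lambda>(i, j). (bead i, gap j)) ` {(i, j). 1 \<le> i \<and> 1 \<le> j \<and> j \<le> p i}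
      = {(a, b). a \<in> X \<and> b \<notin> X \<and> b < a}"
  proof (intro equalityI subsetI)
    fix c assume "c \<in> {(a, b). a \<in> X \<and> b \<notin> X \<and> b < a}"
    then obtain i j where "c = (bead i, gap j)" "1 \<le> i" "1 \<le> j" "gap j < bead i"
      unfolding not_mem_X_iff by (auto simp: X_def)
    then show "c \<in> (\<lambda>(i, j). (bead i, gap j)) ` {(i, j). 1 \<le> i \<and> 1 \<le> j \<and> j \<le> p i}"
      using gap_less_bead_iff by force
  next
    fix c assume "c \<in> (\<lambda>(i, j). (bead i, gap j)) ` {(i, j). 1 \<le> i \<and> 1 \<le> j \<and> j \<le> p i}"
    then show "c \<in> {(a, b). a \<in> X \<and> b \<notin> X \<and> b < a}"
      unfolding not_mem_X_iff by (auto simp: X_def gap_less_bead_iff)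
  qed
qed

end

text \<open>Here \<open>q\<close> is the partition in \<open>DD\<close> and \<open>p\<close> its
  conjugate in \<open>DD'\<close>; \<open>d\<close> is the Durfee size of \<open>q\<close>.\<close>

locale doubled_distinct = conjugate +
  fixes d :: nat
  assumes d: "1 \<le> s \<Longrightarrow> s \<le> q s \<longleftrightarrow> s \<le> d"
    and q_eq: "1 \<le> s \<Longrightarrow> s \<le> d \<Longrightarrow> q s = p s + 1"
begin

lemma gap_eq: "1 \<le> s \<Longrightarrow> s \<le> d \<Longrightarrow> gap s = - bead s"
  using q_eq[of s] by (simp add: bead_def gap_def)

text \<open>A gap at 0 is a column \<open>j\<close> of length exactly \<open>j\<close>. It contains
  the box \<open>(j, j)\<close>, while row \<open>j\<close> would have only \<open>j - 1\<close>
  boxes.\<close>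

lemma zero_mem_X: "0 \<in> X"
proof (rule ccontr)
  assume "0 \<notin> X"
  then obtain j where j: "1 \<le> j" "gap j = 0" unfolding not_mem_X_iff by auto
  then have "q j = j" by (simp add: gap_def)
  then have "j \<le> d" using d[of j] j by simp
  then have "p j + 1 = j" using q_eq j \<open>q j = j\<close> by simp
  then show False using conj[of j j] j \<open>q j = j\<close> by simp
qed

text \<open>Positive beads belong to rows, and negative gaps to columns, with index at most
  \<open>d\<close>; there \<open>gap_eq\<close> matches them by negation.\<close>

lemma pos_mem_X:
  assumes "z > 0"
  shows "z \<in> X \<longleftrightarrow> - z \<notin> X"
proof
  assume "z \<in> X"
  then obtain i where i: "1 \<le> i" "z = bead i" by (auto simp: X_def)
  then have "i \<le> p i" using assms by (simp add: bead_def)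
  then have "i \<le> d" using d[of i] conj[of i i] i by simp
  then have "- z = gap i" using i gap_eq by simp
  then show "- z \<notin> X" using i unfolding not_mem_X_iff by auto
next
  assume "- z \<notin> X"
  then obtain j where j: "1 \<le> j" "- z = gap j" unfolding not_mem_X_iff by auto
  then have "j \<le> q j" using assms by (simp add: gap_def)
  then have "j \<le> d" using d[of j] j by simp
  then have "z = bead j" using gap_eq[of j] j by simp
  then show "z \<in> X" using j by (auto simp: X_def)
qed

lemma symmetric_set_X: "symmetric_set X"
proof
  show "- z \<in> X \<longleftrightarrow> z \<notin> X" if "z \<noteq> 0" for z
    using pos_mem_X[of z] pos_mem_X[of "- z"] that by (cases "z > 0") auto
qed (use zero_mem_X finite_X_pos in auto)

sublocale symmetric_set X
  by (rule symmetric_set_X)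

text \<open>For columns up to \<open>d\<close> the sum compares two beads. Columns beyond
  \<open>d\<close> lie wholly above the diagonal and have positive gaps, so both sides hold.\<close>

lemma bead_plus_gap_pos_iff:
  assumes "1 \<le> i" "1 \<le> j" "j \<le> p i"
  shows "0 < bead i + gap j \<longleftrightarrow> i < j"
proof (cases "j \<le> d")
  case True
  then have "0 < bead i + gap j \<longleftrightarrow> bead j < bead i" using gap_eq[of j] assms by simp
  then show ?thesis using bead_less_iff assms by simp
next
  case False
  then have "q j < j" using d[of j] assms by simp
  moreover have "i \<le> q j" using conj assms by simp
  moreover have "gap j < bead i" using gap_less_bead_iff assms by simp
  ultimately show ?thesis by (simp add: gap_def)
qed

end

section \<open>Lists as partitions: conjugation, boxes and Durfee size\<close>

lemma part_antimono:
  assumes "is_partition lam" "1 \<le> i" "i \<le> i'"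
  shows "part lam i' \<le> part lam i"
proof (cases "i = i'")
  case False
  then show ?thesis
    using assms sorted_wrt_nth_less[of "(\<ge>)" lam "i - 1" "i' - 1"]
    by (auto simp: part_def is_partition_def)
qed simp

lemma part_conj_part:
  assumes "is_partition lam" "1 \<le> j"
  shows "part (conj_part lam) j = card {i. 1 \<le> i \<and> i \<le> length lam \<and> j \<le> part lam i}"
proof (cases "j \<le> part lam 1")
  case True
  then have "[1..<Suc (part lam 1)] ! (j - 1) = j" using assms by (subst nth_upt) auto
  then show ?thesis using assms True
    unfolding part_def[of "conj_part lam"] unfolding conj_part_def
    by (simp del: upt_Suc)
next
  case False
  then have "{i. 1 \<le> i \<and> i \<le> length lam \<and> j \<le> part lam i} = {}"
    using part_antimono[OF assms(1), of 1] by (auto dest: le_trans)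
  then show ?thesis using False
    unfolding part_def[of "conj_part lam"] unfolding conj_part_def
    by (simp del: upt_Suc)
qed

text \<open>The rows of length at least \<open>j\<close> form an initial segment, so a row belongs
  to it iff its number is at most the cardinality.\<close>

lemma conjugate_conj_part:
  assumes "is_partition lam"
  shows "conjugate (part lam) (part (conj_part lam))"
proof
  fix i j :: nat
  assume ij: "1 \<le> i" "1 \<le> j"
  define S where "S = {i. 1 \<le> i \<and> i \<le> length lam \<and> j \<le> part lam i}"
  have fin: "finite S" by (simp add: S_def)
  have mem: "i \<in> S \<longleftrightarrow> j \<le> part lam i" if "1 \<le> i" for i
    using that ij by (auto simp: S_def part_def)
  have "S = {1..card S}"
  proof (cases "S = {}")
    case False
    have "S = {1..Max S}"
    proof (intro equalityI subsetI)
      fix i assume "i \<in> S"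
      then show "i \<in> {1..Max S}" using fin by (auto simp: S_def)
    next
      fix i assume i: "i \<in> {1..Max S}"
      have "Max S \<in> S" using fin False by simp
      then have "j \<le> part lam (Max S)" by (simp add: S_def)
      also have "\<dots> \<le> part lam i" using i by (intro part_antimono[OF assms]) auto
      finally show "i \<in> S" using mem i by simp
    qed
    then show ?thesis by (metis card_atLeastAtMost diff_Suc_1)
  qed simp
  then have "i \<in> S \<longleftrightarrow> i \<le> card S" using ij by (metis atLeastAtMost_iff)
  then show "j \<le> part lam i \<longleftrightarrow> i \<le> part (conj_part lam) j"
    using mem ij part_conj_part[OF assms] by (simp add: S_def)
qed

lemma is_partition_conj_part:
  assumes "is_partition lam"
  shows "is_partition (conj_part lam)"
  unfolding is_partition_def
proof
  let ?c = "\<lambda>j. card {i. 1 \<le> i \<and> i \<le> length lam \<and> j \<le> part lam i}"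
  have "sorted_wrt (\<lambda>a b. ?c a \<ge> ?c b) [1..<Suc (part lam 1)]"
  proof (rule sorted_wrt_mono_rel[OF _ sorted_wrt_upt])
    show "?c a \<ge> ?c b" if "a < b" for a b
      using that by (intro card_mono) auto
  qed
  then show "sorted_wrt (\<ge>) (conj_part lam)"
    by (simp add: conj_part_def sorted_wrt_map del: upt_Suc)
  show "\<forall>c\<in>set (conj_part lam). 0 < c"
  proof
    fix c assume "c \<in> set (conj_part lam)"
    then obtain j where j: "1 \<le> j" "j \<le> part lam 1" "c = ?c j"
      by (auto simp: conj_part_def simp del: upt_Suc)
    then have "1 \<le> length lam" by (auto simp: part_def split: if_splits)
    then have "1 \<in> {i. 1 \<le> i \<and> i \<le> length lam \<and> j \<le> part lam i}" using j by simp
    then show "0 < c" using j by (subst j(3), subst card_gt_0_iff) auto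
  qed
qed

lemma conjugate_unique:
  assumes "conjugate p q" "conjugate p q'" "1 \<le> j"
  shows "q j = q' j"
proof -
  have "i \<le> q j \<longleftrightarrow> i \<le> q' j" if "1 \<le> i" for i
    using conjugate.conj[OF assms(1), of i j] conjugate.conj[OF assms(2), of i j] that assms(3) by simp
  then show ?thesis
    by (metis One_nat_def Suc_leI le_antisym le_refl neq0_conv zero_le)
qed

lemma part_conj_part_conj_part:
  assumes "is_partition lam" "1 \<le> i"
  shows "part (conj_part (conj_part lam)) i = part lam i"
  using conjugate_unique[OF conjugate_conj_part[OF is_partition_conj_part]
      conjugate.sym[OF conjugate_conj_part]] assms by blast

lemma boxes_eq: "boxes lam = {(i, j). 1 \<le> i \<and> 1 \<le> j \<and> j \<le> part lam i}"
  by (auto simp: boxes_def part_def split: if_splits)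

lemma sum_list_eq_card_boxes: "sum_list lam = card (boxes lam)"
proof -
  have "boxes lam = (SIGMA i:{1..length lam}. {1..part lam i})"
    by (auto simp: boxes_def)
  then have "card (boxes lam) = (\<Sum>i=1..length lam. part lam i)" by simp
  also have "\<dots> = (\<Sum>i<length lam. lam ! i)"
    by (rule sum.reindex_bij_witness[of _ Suc "\<lambda>i. i - 1"]) (auto simp: part_def)
  finally show ?thesis by (simp add: sum_list_sum_nth atLeast0LessThan)
qed

lemma le_durfee_iff:
  assumes "is_partition lam" "1 \<le> s"
  shows "s \<le> part lam s \<longleftrightarrow> s \<le> durfee lam"
proof -
  have "{s. s \<le> part lam s} \<subseteq> {..part lam 1}"
  proof
    fix s assume s: "s \<in> {s. s \<le> part lam s}"
    show "s \<in> {..part lam 1}"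
    proof (cases "s = 0")
      case False
      then have "part lam s \<le> part lam 1" by (intro part_antimono[OF assms(1)]) auto
      then show ?thesis using s by simp
    qed simp
  qed
  then have fin: "finite {s. s \<le> part lam s}" by (rule finite_subset) simp
  have "0 \<in> {s. s \<le> part lam s}" by simp
  then have "durfee lam \<in> {s. s \<le> part lam s}"
    unfolding durfee_def using fin by (intro Max_in) auto
  then have "s \<le> part lam s" if "s \<le> durfee lam"
    using part_antimono[OF assms that] that by simp
  then show ?thesis
    unfolding durfee_def using fin by (auto intro: Max_ge)
qed

lemma doubled_distinct_DD':
  assumes "lam \<in> DD'"
  shows "doubled_distinct (part lam) (part (conj_part lam)) (durfee (conj_part lam))"
    and "is_partition lam"
proof -
  obtain mu where mu: "mu \<in> DD" "lam = conj_part mu" using assms by (auto simp: DD'_def)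
  then have part_mu: "is_partition mu" by (simp add: DD_def)
  then show lam: "is_partition lam" using mu is_partition_conj_part by simp
  \<comment> \<open>Conjugating twice returns the parts of \<open>mu\<close>, so the
    \<open>DD\<close> condition on \<open>mu\<close> yields \<open>q_eq\<close>.\<close>
  have q: "part (conj_part lam) s = part mu s" if "1 \<le> s" for s
    using part_conj_part_conj_part[OF part_mu that] mu by simp
  have dur: "durfee (conj_part lam) = durfee mu"
  proof -
    have "{s. s \<le> part (conj_part lam) s} = {s. s \<le> part mu s}"
      using q by (metis One_nat_def Suc_leI neq0_conv zero_le)
    then show ?thesis by (simp add: durfee_def)
  qed
  interpret conjugate "part lam" "part (conj_part lam)" by (rule conjugate_conj_part[OF lam])
  show "doubled_distinct (part lam) (part (conj_part lam)) (durfee (conj_part lam))"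
    unfolding dur
    by unfold_locales (use q le_durfee_iff[OF part_mu] mu in \<open>auto simp: DD_def\<close>)
qed

section \<open>Chains from the quotient\<close>

context symmetric_set
begin

text \<open>By \<open>beta_eq\<close>, these maxima of residue classes are the numbers
  \<open>beta\<close> up to a constant shift.\<close>

definition class_max :: "int \<Rightarrow> int \<Rightarrow> bool" where
  "class_max g z \<longleftrightarrow> z \<in> X \<and> (\<forall>n. z + g * n \<in> X \<longrightarrow> n \<le> 0)"

lemma class_maxI:
  assumes "\<And>n. z + g * n \<in> X \<longleftrightarrow> n \<le> 0"
  shows "class_max g z"
  using assms assms[of 0] by (simp add: class_max_def)

text \<open>The quotient fixes a class only up to a shift \<open>s\<close>. Negation exchanges
  elements and holes of this class except at 0, which is an element; the pattern of an infinite
  part, \<open>m - 1\<close> holes and \<open>m\<close> elements allows this only when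
  unshifted.\<close>

lemma zero_class_shift:
  assumes "h > 0" "m \<ge> 1"
    and cl: "\<And>n. 2 * h * n \<in> X \<longleftrightarrow> n \<le> s - m \<or> s \<le> n \<and> n \<le> s + m - 1"
  shows "s = 0"
proof -
  have sym: "n \<noteq> 0 \<Longrightarrow> 2 * h * (- n) \<in> X \<longleftrightarrow> 2 * h * n \<notin> X" for n
    using mem_minus[of "2 * h * n"] assms(1) by simp
  have zero: "0 \<le> s - m \<or> s \<le> 0 \<and> 0 \<le> s + m - 1"
    using zero_mem cl[of 0] by simp
  show ?thesis
    using zero sym[of "s + m - 1"] sym[of "s - m + 1"] assms(2) unfolding cl by presburger
qed

text \<open>In this class negation acts on indices as \<open>n\<close> to \<open>- 1 - n\<close>,
  without fixed point, which centres the pattern of \<open>m\<close> holes followed by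
  \<open>m\<close> elements.\<close>

lemma half_class_shift:
  assumes "h > 0" "m \<ge> 0"
    and cl: "\<And>n. 2 * h * n + h \<in> X \<longleftrightarrow> n \<le> s - m - 1 \<or> s \<le> n \<and> n \<le> s + m - 1"
  shows "s = 0"
proof -
  have sym: "2 * h * (- 1 - n) + h \<in> X \<longleftrightarrow> 2 * h * n + h \<notin> X" for n
  proof -
    have "2 * h * n + h = h * (2 * n + 1)" by (simp add: algebra_simps)
    moreover have "2 * n + 1 \<noteq> 0" by presburger
    ultimately have "2 * h * n + h \<noteq> 0" using assms(1) by simp
    then show ?thesis using mem_minus[of "2 * h * n + h"] by (simp add: algebra_simps)
  qed
  show ?thesis
    using sym[of "s + m - 1"] sym[of "s - m"] sym[of "s + m"] assms(2) unfolding cl by auto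
qed

text \<open>Negation exchanges the classes of \<open>h + a\<close> and \<open>h - a\<close> modulo
  \<open>2 * h\<close>, so at most one of them has positive elements, and these form one chain. The
  classes of \<open>h\<close> and 0 are their own opposites and give the chains for
  \<open>a = 0\<close> and \<open>a = h\<close>. The last clauses list the maxima of all
  classes.\<close>

lemma chain_decomposition:
  assumes h: "h > 0" and m: "m \<ge> 0" and m1: "m1 \<ge> 1"
    and zero_class: "\<And>n. 2 * h * n \<in> X \<longleftrightarrow> n \<le> - m1 \<or> 0 \<le> n \<and> n \<le> m1 - 1"
    and half_class: "\<And>n. 2 * h * n + h \<in> X \<longleftrightarrow> n \<le> - m - 1 \<or> 0 \<le> n \<and> n \<le> m - 1"
    and generic: "\<And>a. 0 < a \<Longrightarrow> a < h \<Longrightarrow> \<exists>M. \<forall>n. 2 * h * n + h + a \<in> X \<longleftrightarrow> n \<le> M"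
  obtains e :: "int \<Rightarrow> int" and N :: "int \<Rightarrow> nat" and r :: "int \<Rightarrow> int"
  where "r = (\<lambda>a. e a + 2 * h * int (N a))"
    and "\<And>a. 0 \<le> a \<Longrightarrow> \<bar>e a\<bar> = a" and "\<And>a. a \<in> {0..h} \<Longrightarrow> - h < e a"
    and "\<And>a. a \<in> {0..h} \<Longrightarrow> 0 \<le> r a" and "\<And>a. 0 < a \<Longrightarrow> a < h \<Longrightarrow> 0 < r a"
    and "P = (\<Union>a\<in>{0..h}. chain h (e a) (N a))"
    and "\<And>a. a \<in> {0..h} \<Longrightarrow> class_max (2 * h) (r a - h)"
    and "\<And>a. 0 < a \<Longrightarrow> a < h \<Longrightarrow> class_max (2 * h) (- r a - h)"
    and "\<And>c. \<exists>a\<in>{0..h}. \<exists>n. c + 2 * h * n = r a - h \<or> (0 < a \<and> a < h \<and> c + 2 * h * n = - r a - h)"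
proof -
  obtain M where M: "\<And>a n. 0 < a \<Longrightarrow> a < h \<Longrightarrow> 2 * h * n + h + a \<in> X \<longleftrightarrow> n \<le> M a"
    using generic by metis
  \<comment> \<open>The class of \<open>h - a\<close> is the negated complement of the class of
    \<open>h + a\<close>; the element 0 is in neither.\<close>
  have M': "2 * h * n + h - a \<in> X \<longleftrightarrow> n < - M a - 1" if "0 < a" "a < h" for a n
  proof -
    have "2 * h * n + h - a \<noteq> 0"
    proof
      assume 0: "2 * h * n + h - a = 0"
      then have "2 * h dvd h - a" by (metis add_diff_eq dvd_triv_left dvd_add_right_iff dvd_0_right)
      then show False using zdvd_not_zless[of "h - a" "2 * h"] that by simp
    qed
    then have "2 * h * n + h - a \<in> X \<longleftrightarrow> 2 * h * (- n - 1) + h + a \<notin> X"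
      using mem_minus[of "2 * h * n + h - a"] by (simp add: algebra_simps)
    then show ?thesis using M[OF that, of "- n - 1"] by auto
  qed
  \<comment> \<open>The sign of \<open>e a\<close> records which of the two opposite classes carries
    the positive elements.\<close>
  define e where "e a = (if 0 < a \<and> a < h \<and> M a + 1 < 0 then - a else a)" for a
  \<comment> \<open>The entry for \<open>h\<close> is \<open>m1 - 1\<close> because the run in the
    class of 0 begins with 0, which is not positive.\<close>
  define N where "N a = nat (if a = 0 then m else if a = h then m1 - 1 else \<bar>M a + 1\<bar>)" for a
  define r where "r = (\<lambda>a. e a + 2 * h * int (N a))"
  have r0: "r 0 = 2 * h * m" and rh: "r h = 2 * h * m1 - h"
    using h m m1 by (auto simp: r_def e_def N_def algebra_simps)
  have r1: "r a = 2 * h * (M a + 1) + a" if "0 < a" "a < h" "M a + 1 \<ge> 0" for a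
    using that by (auto simp: r_def e_def N_def)
  have r2: "r a = - (2 * h * (M a + 1) + a)" if "0 < a" "a < h" "M a + 1 < 0" for a
    using that by (auto simp: r_def e_def N_def algebra_simps)
  have r_pos: "0 < r a" if a: "0 < a" "a < h" for a
  proof (cases "M a + 1 \<ge> 0")
    case True
    then show ?thesis using r1[OF a True] a h by (simp add: add_nonneg_pos)
  next
    case False
    then have "2 * h * (M a + 1) \<le> 2 * h * (- 1)" using h by (intro mult_left_mono) auto
    then show ?thesis using r2[OF a] False a by simp
  qed
  \<comment> \<open>\<open>q a\<close> is \<open>r a\<close> up to sign. Whatever the sign,
    \<open>q a - h\<close> is the maximum of the class of \<open>h + a\<close>, and
    \<open>- q a - h\<close> that of the class of \<open>h - a\<close>.\<close>
  define q where "q a = 2 * h * (M a + 1) + a" for a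
  have r_q: "r a = q a \<or> r a = - q a" if "0 < a" "a < h" for a
    unfolding q_def using r1[OF that] r2[OF that] by (cases "M a + 1 \<ge> 0") auto
  have max1: "class_max (2 * h) (q a - h)" if "0 < a" "a < h" for a
  proof -
    have eq: "q a - h + 2 * h * n = 2 * h * (M a + n) + h + a" for n
      by (simp add: q_def algebra_simps)
    have "q a - h + 2 * h * n \<in> X \<longleftrightarrow> n \<le> 0" for n
      unfolding eq using M[OF that, of "M a + n"] by simp
    then show ?thesis by (rule class_maxI)
  qed
  have max2: "class_max (2 * h) (- q a - h)" if "0 < a" "a < h" for a
  proof -
    have eq: "- q a - h + 2 * h * n = 2 * h * (- M a - 2 + n) + h - a" for n
      by (simp add: q_def algebra_simps)
    have "- q a - h + 2 * h * n \<in> X \<longleftrightarrow> n \<le> 0" for n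
      unfolding eq using M'[OF that, of "- M a - 2 + n"] by auto
    then show ?thesis by (rule class_maxI)
  qed
  \<comment> \<open>Residues are measured from \<open>h\<close>: offsets 0 and \<open>h\<close> give
    the self-opposite classes, all others come as plus or minus \<open>a\<close>.\<close>
  have split: "(\<exists>n. c = 2 * h * n + h) \<or> (\<exists>n. c = 2 * h * n) \<or>
      (\<exists>n a. 0 < a \<and> a < h \<and> (c = 2 * h * n + h + a \<or> c = 2 * h * n + h - a))" for c
  proof -
    define k where "k = (c - h) mod (2 * h)"
    define n where "n = (c - h) div (2 * h)"
    have c: "c = 2 * h * n + h + k"
      using mult_div_mod_eq[of "2 * h" "c - h"] by (simp add: k_def n_def)
    have k: "0 \<le> k" "k < 2 * h" using h by (simp_all add: k_def)
    consider "k = 0" | "0 < k" "k < h" | "k = h" | "h < k" using k by linarith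
    then show ?thesis
    proof cases
      case 3
      then have "c = 2 * h * (n + 1)" using c by (simp add: algebra_simps)
      then show ?thesis by blast
    next
      case 4
      then have "c = 2 * h * (n + 1) + h - (2 * h - k)" "0 < 2 * h - k" "2 * h - k < h"
        using c k by (simp_all add: algebra_simps)
      then show ?thesis by blast
    qed (use c in auto)
  qed
  show ?thesis
  proof (rule that[OF r_def])
    show "\<bar>e a\<bar> = a" if "0 \<le> a" for a using that by (auto simp: e_def)
    show "- h < e a" if "a \<in> {0..h}" for a using that h by (auto simp: e_def)
    show "0 < r a" if "0 < a" "a < h" for a by (rule r_pos[OF that])
    show "0 \<le> r a" if "a \<in> {0..h}" for a
    proof -
      consider "a = 0" | "a = h" | "0 < a" "a < h" using \<open>a \<in> {0..h}\<close> by force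
      then show ?thesis
      proof cases
        case 2
        have "2 * h * 1 \<le> 2 * h * m1" using h m1 by (intro mult_left_mono) auto
        then show ?thesis using rh 2 h by simp
      qed (use r0 r_pos h m in \<open>auto intro: less_imp_le\<close>)
    qed
    show "class_max (2 * h) (- r a - h)" if "0 < a" "a < h" for a
      using r_q[OF that] max1[OF that] max2[OF that] by auto
    show "class_max (2 * h) (r a - h)" if "a \<in> {0..h}" for a
    proof -
      consider "a = 0" | "a = h" | "0 < a" "a < h" using \<open>a \<in> {0..h}\<close> by force
      then show ?thesis
      proof cases
        case 1
        \<comment> \<open>Index \<open>m - 1\<close> ends the run, or the infinite part if
          \<open>m\<close> is 0. Holes may lie below it, so \<open>class_maxI\<close> does not
          apply.\<close>
        have eq: "r a - h + 2 * h * n = 2 * h * (m - 1 + n) + h" for n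
          unfolding 1 r0 by (simp add: algebra_simps)
        have "r a - h + 2 * h * n \<in> X \<longleftrightarrow> m - 1 + n \<le> - m - 1 \<or> 0 \<le> m - 1 + n \<and> n \<le> 0" for n
          unfolding eq using half_class[of "m - 1 + n"] by auto
        from this this[of 0] show ?thesis using m by (auto simp: class_max_def)
      next
        case 2
        have eq: "r a - h + 2 * h * n = 2 * h * (m1 - 1 + n)" for n
          unfolding 2 rh by (simp add: algebra_simps)
        have "r a - h + 2 * h * n \<in> X \<longleftrightarrow> m1 - 1 + n \<le> - m1 \<or> 0 \<le> m1 - 1 + n \<and> n \<le> 0" for n
          unfolding eq using zero_class[of "m1 - 1 + n"] by auto
        from this this[of 0] show ?thesis using m1 by (auto simp: class_max_def)
      next
        case 3
        then show ?thesis
          using r_q[OF 3] max1[OF 3] max2[OF 3] by auto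
      qed
    qed
    show "\<exists>a\<in>{0..h}. \<exists>n. c + 2 * h * n = r a - h \<or> (0 < a \<and> a < h \<and> c + 2 * h * n = - r a - h)" for c
      using split[of c]
    proof (elim disjE exE conjE)
      fix n assume "c = 2 * h * n + h"
      then have "c + 2 * h * (m - n - 1) = r 0 - h" by (simp add: r0 algebra_simps)
      then show ?thesis using h by (intro bexI[of _ 0]) auto
    next
      fix n assume "c = 2 * h * n"
      then have "c + 2 * h * (m1 - n - 1) = r h - h" by (simp add: rh algebra_simps)
      then show ?thesis using h by (intro bexI[of _ h]) auto
    next
      fix n a assume a: "0 < a" "a < h" and "c = 2 * h * n + h + a"
      then have "c + 2 * h * (M a - n) = q a - h" by (simp add: q_def algebra_simps)
      then have "c + 2 * h * (M a - n) = r a - h \<or> c + 2 * h * (M a - n) = - r a - h"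
        using r_q[OF a] by auto
      then show ?thesis using a by (intro bexI[of _ a]) auto
    next
      fix n a assume a: "0 < a" "a < h" and "c = 2 * h * n + h - a"
      then have "c + 2 * h * (- M a - 2 - n) = - q a - h" by (simp add: q_def algebra_simps)
      then have "c + 2 * h * (- M a - 2 - n) = r a - h \<or> c + 2 * h * (- M a - 2 - n) = - r a - h"
        using r_q[OF a] by auto
      then show ?thesis using a by (intro bexI[of _ a]) auto
    qed
    show "P = (\<Union>a\<in>{0..h}. chain h (e a) (N a))"
    proof (intro equalityI subsetI)
      fix z assume "z \<in> P"
      then have z: "z \<in> X" "z > 0" by (auto simp: P_def)
      have chainI: "z \<in> (\<Union>a\<in>{0..h}. chain h (e a) (N a))"
        if "a \<in> {0..h}" "z = e a + h + 2 * h * n" "n < int (N a)" for a n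
      proof -
        have "n \<ge> 0"
        proof (rule ccontr)
          assume "\<not> n \<ge> 0"
          then have "2 * h * n \<le> 2 * h * (- 1)" using h by (intro mult_left_mono) auto
          moreover have "e a \<le> h" using \<open>a \<in> {0..h}\<close> by (auto simp: e_def)
          ultimately show False using that z by simp
        qed
        then have "z \<in> chain h (e a) (N a)"
          using that unfolding chain_def by (intro image_eqI[of _ _ "nat n"]) auto
        then show ?thesis using that by blast
      qed
      show "z \<in> (\<Union>a\<in>{0..h}. chain h (e a) (N a))"
        using split[of z]
      proof (elim disjE exE conjE)
        fix n assume zn: "z = 2 * h * n + h"
        have "n \<ge> 0"
        proof (rule ccontr)
          assume "\<not> n \<ge> 0"
          then have "2 * h * n \<le> 2 * h * (- 1)" using h by (intro mult_left_mono) auto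
          then show False using zn z h by simp
        qed
        then show ?thesis
          using zn z half_class[of n] h m by (intro chainI[of 0 n]) (auto simp: e_def N_def)
      next
        fix n assume zn: "z = 2 * h * n"
        have "n > 0" using zn z h by (simp add: zero_less_mult_iff)
        then show ?thesis
          using zn z zero_class[of n] h m1
          by (intro chainI[of h "n - 1"]) (auto simp: e_def N_def algebra_simps)
      next
        fix n a assume a: "0 < a" "a < h" and zn: "z = 2 * h * n + h + a"
        have "n \<ge> 0"
        proof (rule ccontr)
          assume "\<not> n \<ge> 0"
          then have "2 * h * n \<le> 2 * h * (- 1)" using h by (intro mult_left_mono) auto
          then show False using zn z a by simp
        qed
        then show ?thesis
          using zn z M[OF a, of n] a by (intro chainI[of a n]) (auto simp: e_def N_def)
      next
        fix n a assume a: "0 < a" "a < h" and zn: "z = 2 * h * n + h - a"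
        have "n \<ge> 0"
        proof (rule ccontr)
          assume "\<not> n \<ge> 0"
          then have "2 * h * n \<le> 2 * h * (- 1)" using h by (intro mult_left_mono) auto
          then show False using zn z a h by simp
        qed
        then show ?thesis
          using zn z M'[OF a, of n] a by (intro chainI[of a n]) (auto simp: e_def N_def)
      qed
    next
      fix z assume "z \<in> (\<Union>a\<in>{0..h}. chain h (e a) (N a))"
      then obtain a j where a: "0 \<le> a" "a \<le> h" and j: "j < N a" and z: "z = e a + h + 2 * h * int j"
        by (auto simp: chain_def)
      have e: "- h < e a" using a h by (auto simp: e_def)
      have "z > 0" using chain_pos[OF e h, of z "N a"] j z by (auto simp: chain_def)
      moreover have "z \<in> X"
      proof -
        consider "a = 0" | "a = h" | "0 < a" "a < h" "M a + 1 \<ge> 0" | "0 < a" "a < h" "M a + 1 < 0"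
          using a by linarith
        then show ?thesis
        proof cases
          case 1
          then show ?thesis
            using z j half_class[of "int j"] by (auto simp: e_def N_def algebra_simps)
        next
          case 2
          then have "z = 2 * h * (int j + 1)" using z h by (simp add: e_def algebra_simps)
          then show ?thesis
            using j 2 h zero_class[of "int j + 1"] by (auto simp: N_def)
        next
          case 3
          then have "z = 2 * h * int j + h + a" using z by (simp add: e_def)
          then show ?thesis using j 3 M[OF 3(1,2), of "int j"] by (auto simp: N_def)
        next
          case 4
          then have "z = 2 * h * int j + h - a" using z by (simp add: e_def)
          then show ?thesis using j 4 M'[OF 4(1,2), of "int j"] by (auto simp: N_def)
        qed
      qed
      ultimately show "z \<in> P" by (simp add: P_def)
    qed
  qed
qed

end

section \<open>Words, coding and quotients\<close>

lemma word_rect: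
  "word (rect a b) k = 0 \<longleftrightarrow> k \<le> - int a - 1 \<or> int b - int a \<le> k \<and> k \<le> int b - 1"
proof -
  have part: "part (rect a b) i = (if 1 \<le> i \<and> i \<le> a then b else 0)" for i
    by (auto simp: part_def rect_def)
  have "(\<exists>i\<ge>1. k = int (part (rect a b) i) - int i)
      \<longleftrightarrow> k \<le> - int a - 1 \<or> int b - int a \<le> k \<and> k \<le> int b - 1"
  proof
    assume "\<exists>i\<ge>1. k = int (part (rect a b) i) - int i"
    then show "k \<le> - int a - 1 \<or> int b - int a \<le> k \<and> k \<le> int b - 1"
      by (auto simp: part split: if_splits)
  next
    assume "k \<le> - int a - 1 \<or> int b - int a \<le> k \<and> k \<le> int b - 1"
    then show "\<exists>i\<ge>1. k = int (part (rect a b) i) - int i"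
    proof
      assume "k \<le> - int a - 1"
      then show ?thesis by (intro exI[of _ "nat (- k)"]) (auto simp: part)
    next
      assume "int b - int a \<le> k \<and> k \<le> int b - 1"
      then show ?thesis by (intro exI[of _ "nat (int b - k)"]) (auto simp: part)
    qed
  qed
  then show ?thesis by (simp add: word_def)
qed

lemma word_Nil: "word [] k = 0 \<longleftrightarrow> k \<le> - 1"
  using word_rect[of 0 0 k] by (auto simp: rect_def)

lemma word_eq_0_iff:
  assumes "is_partition lam"
  shows "word lam k = 0 \<longleftrightarrow> k + 1 \<in> conjugate.X (part lam)"
proof -
  interpret conjugate "part lam" "part (conj_part lam)" by (rule conjugate_conj_part[OF assms])
  show ?thesis by (force simp: word_def X_def bead_def)
qed

text \<open>Position \<open>k' * int g + int k\<close> of the word corresponds to the bead one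
  larger, and \<open>beta\<close> adds a further period; hence the shift
  \<open>int g - 1\<close>.\<close>

lemma beta_eq:
  assumes "is_partition lam" and X: "symmetric_set (conjugate.X (part lam))"
    and max: "symmetric_set.class_max (conjugate.X (part lam)) (int g) z"
    and z: "z = int g * n + int k + 1"
  shows "beta g lam k = z + int g - 1"
  unfolding beta_def
proof (rule Greatest_equality)
  note cm = symmetric_set.class_max_def[OF X]
  show "\<exists>k'. z + int g - 1 = (k' + 1) * int g + int k \<and> word lam (k' * int g + int k) = 0"
    using max z word_eq_0_iff[OF assms(1)] unfolding cm
    by (intro exI[of _ n]) (auto simp: algebra_simps)
  fix b assume "\<exists>k'. b = (k' + 1) * int g + int k \<and> word lam (k' * int g + int k) = 0"
  then obtain k' where b: "b = (k' + 1) * int g + int k"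
    and "k' * int g + int k + 1 \<in> conjugate.X (part lam)"
    using word_eq_0_iff[OF assms(1)] by auto
  moreover have "k' * int g + int k + 1 = z + int g * (k' - n)" using z by (simp add: algebra_simps)
  ultimately have "k' \<le> n" using max unfolding cm by auto
  then have "k' * int g \<le> n * int g" by (intro mult_right_mono) auto
  then show "b \<le> z + int g - 1" using b z by (simp add: algebra_simps)
qed

lemma take_rev_sorted_list_of_set_Un:
  fixes A B :: "'i::linorder set"
  assumes "finite A" "finite B" "\<And>a b. a \<in> A \<Longrightarrow> b \<in> B \<Longrightarrow> b < a"
  shows "take (card A) (rev (sorted_list_of_set (A \<union> B))) = rev (sorted_list_of_set A)"
proof -
  have "sorted_list_of_set (A \<union> B) = sorted_list_of_set B @ sorted_list_of_set A"
  proof (rule sorted_distinct_set_unique)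
    show "sorted (sorted_list_of_set B @ sorted_list_of_set A)"
      using assms by (auto simp: sorted_append intro: less_imp_le)
    show "distinct (sorted_list_of_set B @ sorted_list_of_set A)"
      using assms by fastforce
  qed (use assms in auto)
  then show ?thesis by simp
qed

lemma pair_sum_atLeastAtMost:
  fixes n :: nat
  assumes "\<And>i j. G i j = G j i"
  shows "pair_sum G {1..n} = (\<Sum>i=1..n. \<Sum>j=i+1..n. G i j)"
proof -
  have "pair_sum G {1..n} = (\<Sum>(x, y)\<in>(SIGMA x:{1..n}. {y \<in> {1..n}. y < x}). G x y)"
    unfolding pair_sum_def by (rule sum.Sigma) auto
  also have "\<dots> = (\<Sum>(i, j)\<in>(SIGMA i:{1..n}. {i + 1..n}). G i j)"
    by (rule sum.reindex_bij_witness[of _ prod.swap prod.swap]) (use assms in auto)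
  also have "\<dots> = (\<Sum>i=1..n. \<Sum>j=i+1..n. G i j)"
    by (rule sum.Sigma[symmetric]) auto
  finally show ?thesis .
qed

lemma sum_squares_int:
  fixes h :: int
  assumes "h \<ge> 0"
  shows "6 * (\<Sum>a\<in>{0..h}. a\<^sup>2) = h * (h + 1) * (2 * h + 1)"
  using assms
proof (induction h rule: int_ge_induct)
  case (step h)
  then have "{0..h + 1} = insert (h + 1) {0..h}" by auto
  then show ?case using step by (simp add: power2_eq_square algebra_simps)
qed simp

text \<open>Word index \<open>k\<close> belongs to residue \<open>k + 1\<close> of the bead set, so
  component \<open>2 * t - 3\<close> is the class of 0, component \<open>t - 2\<close> the class of
  \<open>h\<close>, and component \<open>h + a - 1\<close> the class of
  \<open>h + a\<close>.\<close>

lemma DD'2_chains: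
  assumes "t \<ge> 2" "lam \<in> DD'2 t"
  defines "h \<equiv> int t - 1" and "X \<equiv> conjugate.X (part lam)"
  obtains e :: "int \<Rightarrow> int" and N :: "int \<Rightarrow> nat" and r :: "int \<Rightarrow> int"
  where "r = (\<lambda>a. e a + 2 * h * int (N a))"
    and "\<And>a. 0 \<le> a \<Longrightarrow> \<bar>e a\<bar> = a" and "\<And>a. a \<in> {0..h} \<Longrightarrow> - h < e a"
    and "symmetric_set.P X = (\<Union>a\<in>{0..h}. chain h (e a) (N a))"
    and "inj_on r {0..h}" and "\<And>a. a \<in> {0..h} \<Longrightarrow> 0 \<le> r a"
    and "V_coding (2 * t - 2) t lam = rev (sorted_list_of_set ((\<lambda>a. r a + h - 1) ` {0..h}))"
proof -
  have lam: "lam \<in> DD'" using assms by (simp add: DD'2_def)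
  note part = doubled_distinct_DD'(2)[OF lam]
  interpret dd: doubled_distinct "part lam" "part (conj_part lam)" "durfee (conj_part lam)"
    by (rule doubled_distinct_DD'(1)[OF lam])
  interpret symmetric_set X
    unfolding X_def by (rule dd.symmetric_set_X)
  have h: "h > 0" and g: "int (2 * t - 2) = 2 * h" using assms by auto
  obtain nu m1 mt where nu: "is_quotient (2 * t - 2) lam nu"
    and nil: "\<And>k. k < 2 * t - 2 \<Longrightarrow> k \<notin> {t - 2, 2 * t - 3} \<Longrightarrow> nu k = []"
    and m1: "m1 \<ge> 1" "nu (2 * t - 3) = rect m1 (m1 - 1)" and mt: "nu (t - 2) = rect mt mt"
    using assms unfolding DD'2_def by blast
  have quot: "\<exists>s. \<forall>n. 2 * h * n + int k + 1 \<in> X \<longleftrightarrow> word (nu k) (n - s) = 0" if k: "k < 2 * t - 2" for k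
  proof -
    obtain s where s: "\<And>i. word (nu k) i = word lam (2 * h * (i + s) + int k)"
      using nu k unfolding is_quotient_def g by blast
    have "2 * h * n + int k + 1 \<in> X \<longleftrightarrow> word (nu k) (n - s) = 0" for n
      using word_eq_0_iff[OF part, of "2 * h * n + int k"] by (simp add: s X_def)
    then show ?thesis by blast
  qed
  have zero_class: "2 * h * n \<in> X \<longleftrightarrow> n \<le> - int m1 \<or> 0 \<le> n \<and> n \<le> int m1 - 1" for n
  proof -
    have "2 * t - 3 < 2 * t - 2" using assms(1) by simp
    then obtain s where s: "\<And>n. 2 * h * n + int (2 * t - 3) + 1 \<in> X \<longleftrightarrow> word (rect m1 (m1 - 1)) (n - s) = 0"
      using quot[of "2 * t - 3"] unfolding m1(2) by blast
    have cl: "2 * h * n \<in> X \<longleftrightarrow> n \<le> s - int m1 \<or> s \<le> n \<and> n \<le> s + int m1 - 1" for n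
    proof -
      \<comment> \<open>The residue \<open>2 * t - 3 + 1\<close> is a full period, so the element
        \<open>2 * h * n\<close> has index \<open>n - 1\<close> in its component.\<close>
      have eq: "2 * h * (n - 1) + int (2 * t - 3) + 1 = 2 * h * n"
        using assms(1) by (simp add: h_def algebra_simps)
      show ?thesis
        using s[of "n - 1"] m1(1) unfolding word_rect eq by auto
    qed
    have "s = 0"
      by (rule zero_class_shift[OF h, of "int m1"]) (use m1 cl in auto)
    then show ?thesis using cl[of n] by simp
  qed
  have half_class: "2 * h * n + h \<in> X \<longleftrightarrow> n \<le> - int mt - 1 \<or> 0 \<le> n \<and> n \<le> int mt - 1" for n
  proof -
    have "t - 2 < 2 * t - 2" using assms(1) by simp
    then obtain s where s: "\<And>n. 2 * h * n + int (t - 2) + 1 \<in> X \<longleftrightarrow> word (rect mt mt) (n - s) = 0"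
      using quot[of "t - 2"] unfolding mt by blast
    have cl: "2 * h * n + h \<in> X \<longleftrightarrow> n \<le> s - int mt - 1 \<or> s \<le> n \<and> n \<le> s + int mt - 1" for n
    proof -
      have eq: "2 * h * n + int (t - 2) + 1 = 2 * h * n + h"
        using assms(1) by (simp add: h_def)
      show ?thesis
        using s[of n] unfolding word_rect eq by auto
    qed
    have "s = 0"
      by (rule half_class_shift[OF h, of "int mt"]) (use cl in auto)
    then show ?thesis using cl[of n] by simp
  qed
  have generic: "\<exists>M. \<forall>n. 2 * h * n + h + a \<in> X \<longleftrightarrow> n \<le> M" if a: "0 < a" "a < h" for a
  proof -
    define k where "k = nat (h + a - 1)"
    have k: "int k = h + a - 1" "k < 2 * t - 2" "k \<notin> {t - 2, 2 * t - 3}"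
      using a assms by (auto simp: k_def)
    obtain s where s: "\<And>n. 2 * h * n + int k + 1 \<in> X \<longleftrightarrow> word [] (n - s) = 0"
      using quot[OF k(2)] nil[OF k(2,3)] by auto
    have "2 * h * n + h + a \<in> X \<longleftrightarrow> n \<le> s - 1" for n
      using s[of n] k(1) unfolding word_Nil by (auto simp: algebra_simps)
    then show ?thesis by blast
  qed
  have m1_pos: "1 \<le> int m1" using m1 by simp
  obtain e N r where r_eq: "r = (\<lambda>a. e a + 2 * h * int (N a))"
    and abs_e: "\<And>a. 0 \<le> a \<Longrightarrow> \<bar>e a\<bar> = a" and e_gt: "\<And>a. a \<in> {0..h} \<Longrightarrow> - h < e a"
    and r_nonneg: "\<And>a. a \<in> {0..h} \<Longrightarrow> 0 \<le> r a" and r_pos: "\<And>a. 0 < a \<Longrightarrow> a < h \<Longrightarrow> 0 < r a"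
    and P_eq: "P = (\<Union>a\<in>{0..h}. chain h (e a) (N a))"
    and max1: "\<And>a. a \<in> {0..h} \<Longrightarrow> class_max (2 * h) (r a - h)"
    and max2: "\<And>a. 0 < a \<Longrightarrow> a < h \<Longrightarrow> class_max (2 * h) (- r a - h)"
    and cover: "\<And>c. \<exists>a\<in>{0..h}. \<exists>n. c + 2 * h * n = r a - h \<or> (0 < a \<and> a < h \<and> c + 2 * h * n = - r a - h)"
    by (rule chain_decomposition[OF h of_nat_0_le_iff m1_pos zero_class half_class generic])
      (assumption | rule that)+
  have inj: "inj_on r {0..h}"
  proof (rule inj_onI)
    fix a b assume ab: "a \<in> {0..h}" "b \<in> {0..h}" "r a = r b"
    have e_le: "e c \<le> h" if c: "c \<in> {0..h}" for c
      using abs_e[of c] abs_ge_self[of "e c"] c by simp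
    have "e a + 2 * h * int (N a) = e b + 2 * h * int (N b)"
      using ab(3) unfolding r_eq .
    then have "e a = e b"
      by (rule central_residue_unique[OF _ e_gt[OF ab(1)] e_le[OF ab(1)] e_gt[OF ab(2)] e_le[OF ab(2)]])
    then have "\<bar>e a\<bar> = \<bar>e b\<bar>" by (rule arg_cong)
    then show "a = b" using abs_e[of a] abs_e[of b] ab(1,2) by simp
  qed
  \<comment> \<open>The maxima \<open>r a - h\<close> give \<open>A\<close> and the maxima
    \<open>- r a - h\<close> give \<open>B\<close>. As \<open>r\<close> is nonnegative on
    \<open>{0..h}\<close> and positive inside, \<open>A\<close> lies at or above
    \<open>h - 1\<close> and \<open>B\<close> below it, so the coding lists
    \<open>A\<close>.\<close>
  define A where "A = (\<lambda>a. r a + h - 1) ` {0..h}"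
  define B where "B = (\<lambda>a. - r a + h - 1) ` {0<..<h}"
  have beta: "beta (2 * t - 2) lam k = z + 2 * h - 1"
    if "class_max (2 * h) z" "z = 2 * h * n + int k + 1" for z n k
    using beta_eq[OF part dd.symmetric_set_X, of "2 * t - 2" z n k] that unfolding g X_def by simp
  have "beta (2 * t - 2) lam ` {..<2 * t - 2} = A \<union> B"
  proof (intro equalityI subsetI)
    fix b assume "b \<in> beta (2 * t - 2) lam ` {..<2 * t - 2}"
    then obtain k where b: "b = beta (2 * t - 2) lam k" by auto
    obtain a n where an: "a \<in> {0..h}"
      "int k + 1 + 2 * h * n = r a - h \<or> (0 < a \<and> a < h \<and> int k + 1 + 2 * h * n = - r a - h)"
      using cover[of "int k + 1"] by blast
    from an(2) show "b \<in> A \<union> B"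
    proof (elim disjE conjE)
      assume "int k + 1 + 2 * h * n = r a - h"
      then have "b = r a - h + 2 * h - 1"
        unfolding b using an max1 by (intro beta[of _ n]) auto
      then show ?thesis using an by (auto simp: A_def)
    next
      assume *: "0 < a" "a < h" "int k + 1 + 2 * h * n = - r a - h"
      then have "b = - r a - h + 2 * h - 1"
        unfolding b using max2 by (intro beta[of _ n]) auto
      then show ?thesis using * by (auto simp: B_def)
    qed
  next
    fix b assume "b \<in> A \<union> B"
    then obtain z where z: "class_max (2 * h) z" "b = z + 2 * h - 1"
      using max1 max2 by (fastforce simp: A_def B_def)
    define k where "k = nat ((z - 1) mod (2 * h))"
    have k: "int k = (z - 1) mod (2 * h)" using h by (simp add: k_def)
    then have "int k < int (2 * t - 2)" unfolding g using h by simp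
    then have "k < 2 * t - 2" by simp
    moreover have "z = 2 * h * ((z - 1) div (2 * h)) + int k + 1" 
      using mult_div_mod_eq[of "2 * h" "z - 1"] k by simp
    then have "beta (2 * t - 2) lam k = b" using beta[OF z(1)] z(2) by blast
    ultimately show "b \<in> beta (2 * t - 2) lam ` {..<2 * t - 2}" by blast
  qed
  moreover have "card A = t"
  proof -
    have "inj_on (\<lambda>a. r a + h - 1) {0..h}" using inj by (auto simp: inj_on_def)
    then have "card A = card {0..h}" unfolding A_def by (rule card_image)
    then show ?thesis using assms by simp
  qed
  moreover have "b < a" if "a \<in> A" "b \<in> B" for a b
  proof -
    obtain c where "c \<in> {0..h}" "a = r c + h - 1" using \<open>a \<in> A\<close> by (auto simp: A_def)
    moreover obtain c' where "0 < c'" "c' < h" "b = - r c' + h - 1" using \<open>b \<in> B\<close> by (auto simp: B_def)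
    ultimately show ?thesis using r_nonneg[of c] r_pos[of c'] by simp
  qed
  moreover have "finite A" "finite B" by (simp_all add: A_def B_def)
  ultimately have "V_coding (2 * t - 2) t lam = rev (sorted_list_of_set A)"
    unfolding V_coding_def using take_rev_sorted_list_of_set_Un[of A B] by simp
  then have V: "V_coding (2 * t - 2) t lam = rev (sorted_list_of_set ((\<lambda>a. r a + h - 1) ` {0..h}))"
    by (simp only: A_def)
  show ?thesis
    by (rule that[OF r_eq abs_e e_gt P_eq inj r_nonneg V])
qed

section \<open>The unit group of a field\<close>

text \<open>The units of a field, written additively, so that products of quotients become
  sums and differences in an abelian group.\<close>

typedef (overloaded) 'a unit_group = "{c::'a::field. c \<noteq> 0}"
  morphisms of_unit to_unit
  by (rule exI[of _ 1]) simp

setup_lifting type_definition_unit_group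

instantiation unit_group :: (field) ab_group_add
begin

lift_definition zero_unit_group :: "'a unit_group" is 1 by simp

lift_definition plus_unit_group :: "'a unit_group \<Rightarrow> 'a unit_group \<Rightarrow> 'a unit_group" is "(*)" by simp

lift_definition minus_unit_group :: "'a unit_group \<Rightarrow> 'a unit_group \<Rightarrow> 'a unit_group" is "(/)" by simp

lift_definition uminus_unit_group :: "'a unit_group \<Rightarrow> 'a unit_group" is inverse by simp

instance
  by standard (transfer; simp add: field_simps)+

end

lemmas of_unit_simps = zero_unit_group.rep_eq plus_unit_group.rep_eq minus_unit_group.rep_eq

lemma of_unit_sum: "of_unit (sum F A) = (\<Prod>x\<in>A. of_unit (F x))"
  by (induction A rule: infinite_finite_induct) (simp_all add: of_unit_simps)

lemma of_unit_to_unit: "c \<noteq> 0 \<Longrightarrow> of_unit (to_unit c) = c"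
  by (simp add: to_unit_inverse)

section \<open>The product formula\<close>

context symmetric_set
begin

text \<open>Among all arguments of \<open>\<tau>\<close> only \<open>x - y - int g\<close> for boxes
  above the diagonal can be negative; it then equals \<open>- int i\<close> for a hook length
  \<open>int g - int i\<close>.\<close>

lemma prod_H_abs:
  fixes \<tau> :: "int \<Rightarrow> 'a::field" and g :: nat
  assumes nz: "\<And>n. \<tau> n \<noteq> 0"
  shows "(\<Prod>(x, y)\<in>H. \<tau> (x - y - (if 0 < x + y then int g else - int g)) / \<tau> (x - y))
    = (\<Prod>i=1..g - 1. (\<tau> (- int i) / \<tau> (int i)) ^ card {(x, y) \<in> H. x - y = int g - int i \<and> 0 < x + y})
      * (\<Prod>(x, y)\<in>H. \<tau> \<bar>x - y - (if 0 < x + y then int g else - int g)\<bar> / \<tau> \<bar>x - y\<bar>)"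
proof -
  define K where "K = {p \<in> H. 0 < fst p + snd p \<and> fst p - snd p < int g}"
  define c where "c p = \<tau> (- (int g - (fst p - snd p))) / \<tau> (int g - (fst p - snd p))" for p
  have fin: "finite K" using finite_H by (simp add: K_def)
  have "(\<Prod>(x, y)\<in>H. \<tau> (x - y - (if 0 < x + y then int g else - int g)) / \<tau> (x - y))
      = (\<Prod>p\<in>H. (if 0 < fst p + snd p \<and> fst p - snd p < int g then c p else 1)
          * (case p of (x, y) \<Rightarrow> \<tau> \<bar>x - y - (if 0 < x + y then int g else - int g)\<bar> / \<tau> \<bar>x - y\<bar>))"
    using nz by (intro prod.cong) (auto simp: H_def c_def abs_if)
  also have "\<dots> = prod c K
      * (\<Prod>(x, y)\<in>H. \<tau> \<bar>x - y - (if 0 < x + y then int g else - int g)\<bar> / \<tau> \<bar>x - y\<bar>)"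
    unfolding prod.distrib K_def prod.inter_filter[OF finite_H] ..
  also have "prod c K = (\<Prod>i=1..g - 1. \<Prod>p\<in>{p \<in> K. nat (int g - (fst p - snd p)) = i}. c p)"
    by (rule prod.group[symmetric]) (use fin in \<open>auto simp: K_def H_def\<close>)
  also have "\<dots> = (\<Prod>i=1..g - 1. (\<tau> (- int i) / \<tau> (int i))
      ^ card {(x, y) \<in> H. x - y = int g - int i \<and> 0 < x + y})"
  proof (rule prod.cong[OF refl])
    fix i assume i: "i \<in> {1..g - 1}"
    have "{p \<in> K. nat (int g - (fst p - snd p)) = i} = {(x, y) \<in> H. x - y = int g - int i \<and> 0 < x + y}"
      using i by (auto simp: K_def)
    moreover have "c p = \<tau> (- int i) / \<tau> (int i)"
      if "p \<in> {(x, y) \<in> H. x - y = int g - int i \<and> 0 < x + y}" for p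
      using that by (auto simp: c_def)
    ultimately show "(\<Prod>p\<in>{p \<in> K. nat (int g - (fst p - snd p)) = i}. c p)
        = (\<tau> (- int i) / \<tau> (int i)) ^ card {(x, y) \<in> H. x - y = int g - int i \<and> 0 < x + y}"
      by simp
  qed
  finally show ?thesis .
qed

text \<open>This is \<open>chains_identity\<close> for \<open>f\<close> with values in the unit
  group, where absolute values make \<open>f\<close> even.\<close>

lemma prod_H_chains:
  fixes \<tau> :: "int \<Rightarrow> 'a::field" and t :: nat
  assumes nz: "\<And>n. \<tau> n \<noteq> 0" and t: "t \<ge> 2" and h: "h = int t - 1"
    and bij: "bij_betw (\<lambda>i. \<bar>e i\<bar>) {1..t} {0..h}" and e_gt: "\<And>i. i \<in> {1..t} \<Longrightarrow> - h < e i"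
    and P: "P = (\<Union>i\<in>{1..t}. chain h (e i) (N i))" and r: "\<And>i. i \<in> {1..t} \<Longrightarrow> r i = e i + 2 * h * int (N i)"
  shows "(\<Prod>(x, y)\<in>H. \<tau> \<bar>x - y - (if 0 < x + y then 2 * h else - (2 * h))\<bar> / \<tau> \<bar>x - y\<bar>)
    = (\<Prod>i=1..t. \<tau> \<bar>2 * r i\<bar> / \<tau> \<bar>r i\<bar>) * (\<Prod>i=1..t-1. \<tau> (int i) / \<tau> (2 * int i))
      * (\<Prod>i=1..t. \<Prod>j=i+1..t. \<tau> \<bar>r i - r j\<bar> / \<tau> (int j - int i)
          * (\<tau> \<bar>r i + r j\<bar> / \<tau> (2 * int t - int i - int j)))"
proof -
  define f where "f n = to_unit (\<tau> \<bar>n\<bar>)" for n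
  have f: "of_unit (f n) = \<tau> \<bar>n\<bar>" for n
    using nz by (simp add: f_def of_unit_to_unit)
  interpret even_function f h
    by unfold_locales (use t h in \<open>auto simp: f_def\<close>)
  define w where "w b k = f (k - (if b then 2 * h else - (2 * h))) - f k" for b k
  define R where "R = (\<lambda>i. e i + 2 * h * int (N i))"
  have rR: "r i = R i" if "i \<in> {1..t}" for i using r[OF that] by (simp add: R_def)
  have "(\<Sum>(x, y)\<in>H. w (0 < x + y) (x - y))
      = (\<Sum>x\<in>P. (f (2 * x + 2 * h) - f (2 * x)) + (f (x + 2 * h) - f x) + (\<Sum>k\<in>{1..x - 1}. D k))
        + pair_sum (\<lambda>x y. D (x + y) - D (x - y)) P"
    unfolding sum_H by (simp add: w_def D_def)
  also have "\<dots> = (\<Sum>i\<in>{1..t}. f (2 * R i) - f (R i)) + (\<Sum>a\<in>{0..h}. f a - f (2 * a))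
      + pair_sum (\<lambda>i j. \<Theta> (R i) (R j)) {1..t} - pair_sum \<Theta> {0..h}"
    unfolding P R_def by (rule chains_identity[OF _ bij e_gt]) auto
  also have "(\<Sum>a\<in>{0..h}. f a - f (2 * a)) = (\<Sum>i=1..t-1. f (int i) - f (2 * int i))"
  proof -
    have "{0..h} = insert 0 {1..h}" using t h by auto
    moreover have "(\<Sum>a\<in>{1..h}. f a - f (2 * a)) = (\<Sum>i=1..t-1. f (int i) - f (2 * int i))"
      by (rule sum.reindex_bij_witness[of _ int nat]) (use t h in auto)
    ultimately show ?thesis by simp
  qed
  also have "pair_sum (\<lambda>i j. \<Theta> (R i) (R j)) {1..t} = (\<Sum>i=1..t. \<Sum>j=i+1..t. \<Theta> (R i) (R j))"
    by (rule pair_sum_atLeastAtMost) (rule \<Theta>_commute)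
  \<comment> \<open>The substitution \<open>a = t - i\<close> produces the differences
    \<open>j - i\<close> and the sums \<open>2 * t - i - j\<close> of the stated
    denominators.\<close>
  also have "pair_sum \<Theta> {0..h} = (\<Sum>i=1..t. \<Sum>j=i+1..t. \<Theta> (int t - int i) (int t - int j))"
  proof -
    have "{0..h} = (\<lambda>i. int t - int i) ` {1..t}"
    proof (intro equalityI subsetI)
      fix a assume "a \<in> {0..h}"
      then show "a \<in> (\<lambda>i. int t - int i) ` {1..t}"
        using h by (intro image_eqI[of _ _ "nat (int t - a)"]) auto
    qed (use h in auto)
    then have "pair_sum \<Theta> {0..h} = pair_sum (\<lambda>i j. \<Theta> (int t - int i) (int t - int j)) {1..t}"
      using pair_sum_image[of "{1..t}" "\<lambda>i. int t - int i" \<Theta>] \<Theta>_commute by (auto simp: inj_on_def)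
    also have "\<dots> = (\<Sum>i=1..t. \<Sum>j=i+1..t. \<Theta> (int t - int i) (int t - int j))"
      by (rule pair_sum_atLeastAtMost) (rule \<Theta>_commute)
    finally show ?thesis .
  qed
  finally have "of_unit (\<Sum>(x, y)\<in>H. w (0 < x + y) (x - y))
      = of_unit ((\<Sum>i\<in>{1..t}. f (2 * R i) - f (R i)) + (\<Sum>i=1..t-1. f (int i) - f (2 * int i))
          + (\<Sum>i=1..t. \<Sum>j=i+1..t. \<Theta> (R i) (R j) - \<Theta> (int t - int i) (int t - int j)))"
    by (simp add: sum_subtractf add_diff_eq)
  moreover have "of_unit (\<Sum>(x, y)\<in>H. w (0 < x + y) (x - y))
      = (\<Prod>(x, y)\<in>H. \<tau> \<bar>x - y - (if 0 < x + y then 2 * h else - (2 * h))\<bar> / \<tau> \<bar>x - y\<bar>)"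
    unfolding of_unit_sum by (intro prod.cong) (auto simp: w_def of_unit_simps f)
  moreover have "of_unit (\<Sum>i\<in>{1..t}. f (2 * R i) - f (R i)) = (\<Prod>i=1..t. \<tau> \<bar>2 * r i\<bar> / \<tau> \<bar>r i\<bar>)"
    unfolding of_unit_sum by (intro prod.cong) (auto simp: of_unit_simps f rR)
  moreover have "of_unit (\<Sum>i=1..t-1. f (int i) - f (2 * int i)) = (\<Prod>i=1..t-1. \<tau> (int i) / \<tau> (2 * int i))"
    unfolding of_unit_sum by (intro prod.cong) (auto simp: of_unit_simps f)
  moreover have "of_unit (\<Sum>i=1..t. \<Sum>j=i+1..t. \<Theta> (R i) (R j) - \<Theta> (int t - int i) (int t - int j))
      = (\<Prod>i=1..t. \<Prod>j=i+1..t. \<tau> \<bar>r i - r j\<bar> / \<tau> (int j - int i)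
          * (\<tau> \<bar>r i + r j\<bar> / \<tau> (2 * int t - int i - int j)))"
    unfolding of_unit_sum
    by (intro prod.cong) (auto simp: of_unit_simps \<Theta>_def f rR algebra_simps)
  ultimately show ?thesis by (simp add: of_unit_simps)
qed

text \<open>The count of \<open>card_H\<close> telescopes along each chain to a difference of
  squares, and the squares of the \<open>e i\<close> are those of \<open>{0..h}\<close>.\<close>

lemma card_H_chains:
  assumes h: "h > 0" and "finite I"
    and bij: "bij_betw (\<lambda>i. \<bar>e i\<bar>) I {0..h}" and e_gt: "\<And>i. i \<in> I \<Longrightarrow> - h < e i"
    and P: "P = (\<Union>i\<in>I. chain h (e i) (N i))" and r: "\<And>i. i \<in> I \<Longrightarrow> r i = e i + 2 * h * int (N i)"
  shows "2 * h * int (card H) = (\<Sum>i\<in>I. (r i)\<^sup>2) - (\<Sum>a\<in>{0..h}. a\<^sup>2)"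
proof -
  have e_le: "e i \<le> h" if "i \<in> I" for i
    using bij_betwE[OF bij] that by (force simp: abs_if split: if_splits)
  have e_inj: "e i \<noteq> e j" if "i \<in> I" "j \<in> I" "i \<noteq> j" for i j
    using bij_betw_imp_inj_on[OF bij] that by (auto simp: inj_on_def)
  have "int (card H) = (\<Sum>i\<in>I. \<Sum>x\<in>chain h (e i) (N i). 2 * x)"
    unfolding card_H P using assms(2) chains_disjoint[OF e_inj] e_gt e_le
    by (intro sum.UNION_disjoint) auto
  then have "2 * h * int (card H) = (\<Sum>i\<in>I. 2 * h * (\<Sum>x\<in>chain h (e i) (N i). 2 * x))"
    by (simp only: sum_distrib_left)
  also have "\<dots> = (\<Sum>i\<in>I. (r i)\<^sup>2 - \<bar>e i\<bar>\<^sup>2)"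
    unfolding sum_double_chain[OF h] using r by simp
  also have "\<dots> = (\<Sum>i\<in>I. (r i)\<^sup>2) - (\<Sum>a\<in>{0..h}. a\<^sup>2)"
    unfolding sum_subtractf sum.reindex_bij_betw[OF bij, of "\<lambda>a. a\<^sup>2"] ..
  finally show ?thesis .
qed

end

lemma sorted_list_of_set_decreasing:
  fixes A :: "'i::linorder set"
  assumes "finite A"
  defines "v \<equiv> rev (sorted_list_of_set A)"
  shows "bij_betw (\<lambda>i. v ! (i - 1)) {1..card A} A"
    and "1 \<le> i \<Longrightarrow> i < j \<Longrightarrow> j \<le> card A \<Longrightarrow> v ! (j - 1) < v ! (i - 1)"
proof -
  have len: "length v = card A" using assms by simp
  have "bij_betw (\<lambda>i. i - 1) {1..card A} {..<length v}"
    unfolding len by (rule bij_betw_byWitness[of _ Suc]) auto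
  moreover have "bij_betw ((!) v) {..<length v} A"
    by (rule bij_betw_nth) (use assms in auto)
  ultimately show "bij_betw (\<lambda>i. v ! (i - 1)) {1..card A} A"
    using bij_betw_trans[of "\<lambda>i. i - 1" _ _ "(!) v"] by (simp add: comp_def)
  have "sorted_wrt (>) v"
    unfolding v_def sorted_wrt_rev by simp
  then show "1 \<le> i \<Longrightarrow> i < j \<Longrightarrow> j \<le> card A \<Longrightarrow> v ! (j - 1) < v ! (i - 1)"
    using sorted_wrt_nth_less[of "(>)" v "i - 1" "j - 1"] len by simp
qed

section \<open>Size and product formulas in terms of the coding\<close>

theorem theorem4p27:
  fixes t g :: nat and lam :: "nat list" and v :: "int list" and r :: "nat \<Rightarrow> int"
    and \<tau> :: "int \<Rightarrow> 'a::field"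
  assumes "t \<ge> 2" and "g = 2 * t - 2"
    and "lam \<in> DD'2 t"
    and "v = V_coding g t lam"
    and "\<And>i. 1 \<le> i \<Longrightarrow> i \<le> t \<Longrightarrow> r i = v ! (i - 1) - int (g div 2) + 1"
    and "\<And>n. \<tau> n \<noteq> 0"
  shows "real (sum_list lam)
      = 1 / real g * (\<Sum>i=1..t. (real_of_int (r i))\<^sup>2) - (real g / 2 + 1) * (real g + 1) / 12
    \<and> (\<Prod>s\<in>boxes lam. \<tau> (hook lam s - eps' s * int g) / \<tau> (hook lam s))
      = (\<Prod>s\<in>boxes (conj_part lam).
          \<tau> (hook (conj_part lam) s + eps s * int g) / \<tau> (hook (conj_part lam) s))
    \<and> (\<Prod>s\<in>boxes (conj_part lam).
          \<tau> (hook (conj_part lam) s + eps s * int g) / \<tau> (hook (conj_part lam) s))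
      = (\<Prod>i=1..g-1. (\<tau> (- int i) / \<tau> (int i)) ^ alpha g lam i)
        * (\<Prod>i=1..t. \<tau> (2 * r i) / \<tau> (r i))
        * (\<Prod>i=1..t-1. \<tau> (int i) / \<tau> (2 * int i))
        * (\<Prod>i=1..t. \<Prod>j=i+1..t. \<tau> (r i - r j) / \<tau> (int j - int i)
            * (\<tau> (r i + r j) / \<tau> (int g + 2 - int i - int j)))"
proof -
  define h where "h = int t - 1"
  have h: "h > 0" and g: "int g = 2 * h" and half: "int (g div 2) = h"
    using assms(1,2) by (auto simp: h_def)
  have lam: "lam \<in> DD'" using assms(3) by (simp add: DD'2_def)
  note part = doubled_distinct_DD'(2)[OF lam]
  interpret doubled_distinct "part lam" "part (conj_part lam)" "durfee (conj_part lam)"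
    by (rule doubled_distinct_DD'(1)[OF lam])
  obtain e N \<rho> where \<rho>_eq: "\<rho> = (\<lambda>a. e a + 2 * h * int (N a))"
    and abs_e: "\<And>a. 0 \<le> a \<Longrightarrow> \<bar>e a\<bar> = a" and e_gt: "\<And>a. a \<in> {0..h} \<Longrightarrow> - h < e a"
    and P_eq: "P = (\<Union>a\<in>{0..h}. chain h (e a) (N a))"
    and inj: "inj_on \<rho> {0..h}" and \<rho>_nonneg: "\<And>a. a \<in> {0..h} \<Longrightarrow> 0 \<le> \<rho> a"
    and v: "V_coding g t lam = rev (sorted_list_of_set ((\<lambda>a. \<rho> a + h - 1) ` {0..h}))"
    by (rule DD'2_chains[OF assms(1,3), folded h_def assms(2)]) (rule that; assumption)
  define A where "A = (\<lambda>a. \<rho> a + h - 1) ` {0..h}"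
  have injA: "inj_on (\<lambda>a. \<rho> a + h - 1) {0..h}" using inj by (auto simp: inj_on_def)
  have cardA: "card A = t" and finA: "finite A"
    using card_image[OF injA] by (simp_all add: A_def h_def)
  have v': "v = rev (sorted_list_of_set A)" using v assms(4) by (simp add: A_def)
  have r: "r i = v ! (i - 1) - h + 1" if "i \<in> {1..t}" for i
    using assms(5) that half by simp
  \<comment> \<open>\<open>a i\<close> names the chain whose upper end is the \<open>i\<close>-th
    largest; it renumbers the chains by \<open>{1..t}\<close> in the order of the coding.\<close>
  define a where "a i = inv_into {0..h} (\<lambda>a. \<rho> a + h - 1) (v ! (i - 1))" for i
  have bij_v: "bij_betw (\<lambda>i. v ! (i - 1)) {1..t} A"
    using sorted_list_of_set_decreasing(1)[OF finA] unfolding v' cardA .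
  have "bij_betw (inv_into {0..h} (\<lambda>a. \<rho> a + h - 1)) A {0..h}"
    unfolding A_def using injA by (intro bij_betw_inv_into) (simp add: bij_betw_def)
  then have bij_a: "bij_betw a {1..t} {0..h}"
    using bij_betw_trans[OF bij_v] unfolding a_def comp_def by blast
  have a_mem: "a i \<in> {0..h}" if "i \<in> {1..t}" for i
    using bij_betwE[OF bij_a] that by blast
  have r\<rho>: "r i = \<rho> (a i)" if "i \<in> {1..t}" for i
  proof -
    have "v ! (i - 1) \<in> (\<lambda>a. \<rho> a + h - 1) ` {0..h}"
      using bij_betwE[OF bij_v] that by (simp add: A_def)
    then have "\<rho> (a i) + h - 1 = v ! (i - 1)" unfolding a_def by (rule f_inv_into_f)
    then show ?thesis using r[OF that] by simp
  qed
  have r_nonneg: "0 \<le> r i" if "i \<in> {1..t}" for i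
    using \<rho>_nonneg[OF a_mem[OF that]] r\<rho>[OF that] by simp
  have r_less: "r j < r i" if "1 \<le> i" "i < j" "j \<le> t" for i j
    using sorted_list_of_set_decreasing(2)[OF finA, of i j] r[of i] r[of j] that
    unfolding v' cardA by simp
  have bij_e: "bij_betw (\<lambda>i. \<bar>e (a i)\<bar>) {1..t} {0..h}"
    using bij_a a_mem abs_e by (subst bij_betw_cong[of _ _ a]) auto
  have e_gt': "- h < e (a i)" if "i \<in> {1..t}" for i
    using e_gt[OF a_mem[OF that]] .
  have P': "P = (\<Union>i\<in>{1..t}. chain h (e (a i)) (N (a i)))"
    unfolding P_eq bij_betw_imp_surj_on[OF bij_a, symmetric] by blast
  have r': "r i = e (a i) + 2 * h * int (N (a i))" if "i \<in> {1..t}" for i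
    using r\<rho>[OF that] by (simp add: \<rho>_eq)

  have bij: "bij_betw (\<lambda>(i, j). (bead i, gap j)) (boxes lam) H"
    using bij_betw_boxes unfolding boxes_eq H_def .
  have hook: "hook lam (i, j) = bead i - gap j" for i j
    by (simp add: hook_def bead_def gap_def)
  have eps': "eps' (i, j) = (if 0 < bead i + gap j then 1 else - 1)" if "(i, j) \<in> boxes lam" for i j
    using that bead_plus_gap_pos_iff by (simp add: boxes_eq eps'_def)

  have "2 * h * int (card (boxes lam)) = (\<Sum>i\<in>{1..t}. (r i)\<^sup>2) - (\<Sum>a\<in>{0..h}. a\<^sup>2)"
    unfolding bij_betw_same_card[OF bij] by (rule card_H_chains[OF h _ bij_e e_gt' P' r']) auto
  then have "12 * h * int (sum_list lam) = 6 * (\<Sum>i\<in>{1..t}. (r i)\<^sup>2) - h * (h + 1) * (2 * h + 1)"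
    using sum_squares_int[of h] h by (simp add: sum_list_eq_card_boxes)
  then have "real_of_int (12 * h * int (sum_list lam))
      = real_of_int (6 * (\<Sum>i\<in>{1..t}. (r i)\<^sup>2) - h * (h + 1) * (2 * h + 1))"
    by (simp only:)
  moreover have "real g = 2 * real_of_int h" using g by (metis of_int_mult of_int_numeral of_int_of_nat_eq)
  ultimately have size: "real (sum_list lam)
      = 1 / real g * (\<Sum>i=1..t. (real_of_int (r i))\<^sup>2) - (real g / 2 + 1) * (real g + 1) / 12"
    using h by (simp add: field_simps)

  \<comment> \<open>Transposition preserves hook lengths and turns \<open>eps'\<close> into minus
    \<open>eps\<close>, including on the diagonal.\<close>
  have conj: "(\<Prod>s\<in>boxes lam. \<tau> (hook lam s - eps' s * int g) / \<tau> (hook lam s))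
      = (\<Prod>s\<in>boxes (conj_part lam).
          \<tau> (hook (conj_part lam) s + eps s * int g) / \<tau> (hook (conj_part lam) s))"
  proof (rule prod.reindex_bij_witness[of _ prod.swap prod.swap])
    fix s assume "s \<in> boxes lam"
    then obtain i j where s: "s = (i, j)" "1 \<le> i" "1 \<le> j" "j \<le> part lam i"
      by (auto simp: boxes_eq)
    show "prod.swap s \<in> boxes (conj_part lam)" using s conj by (simp add: boxes_eq)
    show "\<tau> (hook (conj_part lam) (prod.swap s) + eps (prod.swap s) * int g) / \<tau> (hook (conj_part lam) (prod.swap s))
        = \<tau> (hook lam s - eps' s * int g) / \<tau> (hook lam s)"
      using s part_conj_part_conj_part[OF part, of i]
      by (simp add: hook_def eps_def eps'_def algebra_simps)
  next
    fix s assume "s \<in> boxes (conj_part lam)"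
    then show "prod.swap s \<in> boxes lam" using conj by (auto simp: boxes_eq)
  qed auto

  have "(\<Prod>s\<in>boxes lam. \<tau> (hook lam s - eps' s * int g) / \<tau> (hook lam s))
      = (\<Prod>(x, y)\<in>H. \<tau> (x - y - (if 0 < x + y then int g else - int g)) / \<tau> (x - y))"
    unfolding prod.reindex_bij_betw[OF bij, symmetric]
    by (intro prod.cong) (auto simp: hook eps')
  also have "\<dots> = (\<Prod>i=1..g - 1. (\<tau> (- int i) / \<tau> (int i))
        ^ card {(x, y) \<in> H. x - y = int g - int i \<and> 0 < x + y})
      * (\<Prod>(x, y)\<in>H. \<tau> \<bar>x - y - (if 0 < x + y then int g else - int g)\<bar> / \<tau> \<bar>x - y\<bar>)"
    by (rule prod_H_abs[OF assms(6)])
  also have "(\<lambda>i. card {(x, y) \<in> H. x - y = int g - int i \<and> 0 < x + y}) = alpha g lam"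
  proof
    fix i
    have "bij_betw (\<lambda>(i, j). (bead i, gap j)) {s \<in> boxes lam. hook lam s = int g - int i \<and> eps' s = 1}
        {(x, y) \<in> H. x - y = int g - int i \<and> 0 < x + y}"
    proof (rule bij_betw_subset[OF bij, of _ "{(x, y) \<in> H. x - y = int g - int i \<and> 0 < x + y}", rotated])
      show "(\<lambda>(i, j). (bead i, gap j)) ` {s \<in> boxes lam. hook lam s = int g - int i \<and> eps' s = 1}
          = {(x, y) \<in> H. x - y = int g - int i \<and> 0 < x + y}"
        unfolding bij_betw_imp_surj_on[OF bij, symmetric]
        by (force simp: hook eps' split: if_splits)
    qed auto
    then show "card {(x, y) \<in> H. x - y = int g - int i \<and> 0 < x + y} = alpha g lam i"
      unfolding alpha_def by (simp add: bij_betw_same_card)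
  qed
  also have "(\<Prod>(x, y)\<in>H. \<tau> \<bar>x - y - (if 0 < x + y then int g else - int g)\<bar> / \<tau> \<bar>x - y\<bar>)
      = (\<Prod>i=1..t. \<tau> \<bar>2 * r i\<bar> / \<tau> \<bar>r i\<bar>) * (\<Prod>i=1..t-1. \<tau> (int i) / \<tau> (2 * int i))
        * (\<Prod>i=1..t. \<Prod>j=i+1..t. \<tau> \<bar>r i - r j\<bar> / \<tau> (int j - int i)
            * (\<tau> \<bar>r i + r j\<bar> / \<tau> (2 * int t - int i - int j)))"
    unfolding g by (rule prod_H_chains[OF assms(6,1) h_def bij_e e_gt' P' r'])
  \<comment> \<open>The absolute values drop out because the \<open>r i\<close> are nonnegative and
    strictly decreasing.\<close>
  also have "(\<Prod>i=1..t. \<tau> \<bar>2 * r i\<bar> / \<tau> \<bar>r i\<bar>) = (\<Prod>i=1..t. \<tau> (2 * r i) / \<tau> (r i))"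
    by (intro prod.cong) (use r_nonneg in auto)
  also have "(\<Prod>i=1..t. \<Prod>j=i+1..t. \<tau> \<bar>r i - r j\<bar> / \<tau> (int j - int i)
            * (\<tau> \<bar>r i + r j\<bar> / \<tau> (2 * int t - int i - int j)))
      = (\<Prod>i=1..t. \<Prod>j=i+1..t. \<tau> (r i - r j) / \<tau> (int j - int i)
            * (\<tau> (r i + r j) / \<tau> (int g + 2 - int i - int j)))"
  proof (intro prod.cong refl)
    fix i j assume ij: "i \<in> {1..t}" "j \<in> {i + 1..t}"
    have "\<bar>r i - r j\<bar> = r i - r j" using r_less[of i j] ij by simp
    moreover have "\<bar>r i + r j\<bar> = r i + r j" using r_nonneg[of i] r_nonneg[of j] ij by simp
    moreover have "2 * int t = int g + 2" using g by (simp add: h_def)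
    ultimately show "\<tau> \<bar>r i - r j\<bar> / \<tau> (int j - int i) * (\<tau> \<bar>r i + r j\<bar> / \<tau> (2 * int t - int i - int j))
        = \<tau> (r i - r j) / \<tau> (int j - int i) * (\<tau> (r i + r j) / \<tau> (int g + 2 - int i - int j))"
      by simp
  qed
  finally show ?thesis
    using size conj by (simp add: mult.assoc)
qed

end
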